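(* Let $\mathcal{A}$ be a T-algebra of rank $r$, so that $\operatorname{cl}\mathcal{K}(\mathcal{A})$ is a homogeneous cone of rank $r$. Then the length of a longest chain of faces of $\operatorname{cl}\mathcal{K}(\mathcal{A})$ is $r+1$.
   Context: Matrix algebra with involution of rank $r$: a finite-dimensional real (not necessarily associative) algebra $\mathcal{A}=\bigoplus_{i,j=1}^r\mathcal{A}_{ij}$ (direct sum of subspaces) with $\mathcal{A}_{ij}\mathcal{A}_{jk}\subseteq\mathcal{A}_{ik}$ and $\mathcal{A}_{ij}\mathcal{A}_{kl}=\{0\}$ if $j\ne k$, with a linear bijection $*:\mathcal{A}\to\mathcal{A}$ satisfying $a^{**}=a$, $(ab)^*=b^*a^*$, $\mathcal{A}_{ij}^*=\mathcal{A}_{ji}$. Write $a=\sum_{i,j}a_{ij}$ with $a_{ij}\in\mathcal{A}_{ij}$; $b_{lk}^*$ means $(b_{lk})^*$. It is a T-algebra of rank $r$ if: (a1) each $\mathcal{A}_{ii}$ is a subalgebra isomorphic to $\mathbb{R}$, via an algebra isomorphism $\rho_i:\mathcal{A}_{ii}\to\mathbb{R}$; let $e_i\in\mathcal{A}_{ii}$ with $\rho_i(e_i)=1$ and $\operatorname{tr}(a)=\sum_i\rho_i(a_{ii})$; (a2) $e_ia_{ij}=a_{ij}$ and $a_{ji}e_i=a_{ji}$ for all $a,i,j$; (a3) $\operatorname{tr}(ab)=\operatorname{tr}(ba)$; (a4) $\operatorname{tr}((ab)c)=\operatorname{tr}(a(bc))$; (a5) $\operatorname{tr}(aa^* )\ge0$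 with equality iff $a=0$; (a6) $a_{ij}(b_{jk}c_{kl})=(a_{ij}b_{jk})c_{kl}$ for all $a,b,c$ and $1\le i\le j\le k\le l\le r$; (a7) $a_{ij}(b_{jk}b_{lk}^* )=(a_{ij}b_{jk})b_{lk}^*$ for all $a,b$, $1\le i\le j\le k\le r$ and $1\le l\le k\le r$. Let $\mathcal{H}(\mathcal{A})=\{a: a^*=a\}$, $\mathcal{T}(\mathcal{A})=\bigoplus_{i\le j}\mathcal{A}_{ij}$, $\mathcal{T}_{++}(\mathcal{A})=\{a\in\mathcal{T}(\mathcal{A}):\rho_i(a_{ii})>0\ \forall i\}$. Set $\mathcal{K}(\mathcal{A})=\{tt^*: t\in\mathcal{T}_{++}(\mathcal{A})\}$, an open convex cone in $\mathcal{H}(\mathcal{A})$, with closure $\operatorname{cl}\mathcal{K}(\mathcal{A})$. A face of a convex cone $\mathcal{K}$ is a nonempty convex cone $\mathcal{F}\subseteq\mathcal{K}$ such that $x,y\in\mathcal{K}$, $x+y\in\mathcal{F}$ imply $x,y\in\mathcal{F}$. A chain of faces of length $\ell$ is a sequence of faces $\mathcal{F}_1\subsetneq\cdots\subsetneq\mathcal{F}_\ell$ of the cone. *)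

theory Defs
  imports "HOL-Analysis.Analysis"
begin

text \<open>
  The finite-dimensional real algebra is a Euclidean space \<open>'a\<close> with a bilinear, not necessarily
  associative, product \<open>mul\<close>. Only the vector space structure and the topology of \<open>'a\<close> matter;
  its inner product is unrelated to the trace form. The graded pieces are \<open>A i j\<close> for
  \<open>i, j \<in> {1..r}\<close>; values of \<open>A\<close> outside this range are irrelevant.
\<close>

definition is_decomposition ::
  "nat \<Rightarrow> (nat \<Rightarrow> nat \<Rightarrow> 'a::euclidean_space set) \<Rightarrow> 'a \<Rightarrow> (nat \<Rightarrow> nat \<Rightarrow> 'a) \<Rightarrow> bool" where
  "is_decomposition r A a f \<longleftrightarrow>
     (\<forall>i\<in>{1..r}. \<forall>j\<in>{1..r}. f i j \<in> A i j) \<and>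
     (\<forall>i j. i \<notin> {1..r} \<or> j \<notin> {1..r} \<longrightarrow> f i j = 0) \<and>
     a = (\<Sum>i\<in>{1..r}. \<Sum>j\<in>{1..r}. f i j)"

text \<open>\<open>component r A a i j\<close> is \<open>a\<^sub>i\<^sub>j\<close>; it is meaningful when the sum of the \<open>A i j\<close> is direct.\<close>

definition component ::
  "nat \<Rightarrow> (nat \<Rightarrow> nat \<Rightarrow> 'a::euclidean_space set) \<Rightarrow> 'a \<Rightarrow> nat \<Rightarrow> nat \<Rightarrow> 'a" where
  "component r A a = (THE f. is_decomposition r A a f)"

locale matrix_algebra_with_involution =
  fixes r :: nat
    and A :: "nat \<Rightarrow> nat \<Rightarrow> 'a::euclidean_space set"
    and mul :: "'a \<Rightarrow> 'a \<Rightarrow> 'a"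
    and star :: "'a \<Rightarrow> 'a"
  assumes bilinear_mul: "bilinear mul"
    and subspace_A: "\<And>i j. i \<in> {1..r} \<Longrightarrow> j \<in> {1..r} \<Longrightarrow> subspace (A i j)"
    and direct_sum: "\<And>a. \<exists>!f. is_decomposition r A a f"
    and mul_in: "\<And>i j k a b. i \<in> {1..r} \<Longrightarrow> j \<in> {1..r} \<Longrightarrow> k \<in> {1..r} \<Longrightarrow>
      a \<in> A i j \<Longrightarrow> b \<in> A j k \<Longrightarrow> mul a b \<in> A i k"
    and mul_zero: "\<And>i j k l a b. i \<in> {1..r} \<Longrightarrow> j \<in> {1..r} \<Longrightarrow> k \<in> {1..r} \<Longrightarrow> l \<in> {1..r} \<Longrightarrow>
      j \<noteq> k \<Longrightarrow> a \<in> A i j \<Longrightarrow> b \<in> A k l \<Longrightarrow> mul a b = 0"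
    and linear_star: "linear star"
    and bij_star: "bij star"
    and star_star: "\<And>a. star (star a) = a"
    and star_mul: "\<And>a b. star (mul a b) = mul (star b) (star a)"
    and star_A: "\<And>i j. i \<in> {1..r} \<Longrightarrow> j \<in> {1..r} \<Longrightarrow> star ` A i j = A j i"

text \<open>An algebra isomorphism from \<open>S\<close> onto the reals; only the values of \<open>f\<close> on \<open>S\<close> matter.\<close>

definition algebra_iso_real ::
  "'a::real_vector set \<Rightarrow> ('a \<Rightarrow> 'a \<Rightarrow> 'a) \<Rightarrow> ('a \<Rightarrow> real) \<Rightarrow> bool" where
  "algebra_iso_real S mul f \<longleftrightarrow>
     bij_betw f S UNIV \<and>
     (\<forall>x\<in>S. \<forall>y\<in>S. f (x + y) = f x + f y) \<and>
     (\<forall>c. \<forall>x\<in>S. f (c *\<^sub>R x) = c * f x) \<and>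
     (\<forall>x\<in>S. \<forall>y\<in>S. f (mul x y) = f x * f y)"

definition diag_unit ::
  "(nat \<Rightarrow> nat \<Rightarrow> 'a set) \<Rightarrow> (nat \<Rightarrow> 'a \<Rightarrow> real) \<Rightarrow> nat \<Rightarrow> 'a" where
  "diag_unit A \<rho> i = (THE e. e \<in> A i i \<and> \<rho> i e = 1)"

definition alg_trace ::
  "nat \<Rightarrow> (nat \<Rightarrow> nat \<Rightarrow> 'a::euclidean_space set) \<Rightarrow> (nat \<Rightarrow> 'a \<Rightarrow> real) \<Rightarrow> 'a \<Rightarrow> real" where
  "alg_trace r A \<rho> a = (\<Sum>i\<in>{1..r}. \<rho> i (component r A a i i))"

text \<open>
  In \<open>a7\<close> the two factors \<open>b\<^sub>j\<^sub>k\<close> and \<open>b\<^sub>l\<^sub>k\<close> are components of the same element \<open>b\<close>, so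
  they coincide when \<open>l = j\<close>; the axiom must not be read with independent factors.
\<close>

locale T_algebra = matrix_algebra_with_involution r A mul star
  for r :: nat
    and A :: "nat \<Rightarrow> nat \<Rightarrow> 'a::euclidean_space set"
    and mul :: "'a \<Rightarrow> 'a \<Rightarrow> 'a"
    and star :: "'a \<Rightarrow> 'a" +
  fixes \<rho> :: "nat \<Rightarrow> 'a \<Rightarrow> real"
  assumes a1: "\<And>i. i \<in> {1..r} \<Longrightarrow> algebra_iso_real (A i i) mul (\<rho> i)"
    and a2: "\<And>a i j. i \<in> {1..r} \<Longrightarrow> j \<in> {1..r} \<Longrightarrow>
      mul (diag_unit A \<rho> i) (component r A a i j) = component r A a i j \<and>
      mul (component r A a j i) (diag_unit A \<rho> i) = component r A a j i"
    and a3: "\<And>a b. alg_trace r A \<rho> (mul a b) = alg_trace r A \<rho> (mul b a)"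
    and a4: "\<And>a b c. alg_trace r A \<rho> (mul (mul a b) c) = alg_trace r A \<rho> (mul a (mul b c))"
    and a5: "\<And>a. alg_trace r A \<rho> (mul a (star a)) \<ge> 0 \<and>
      (alg_trace r A \<rho> (mul a (star a)) = 0 \<longleftrightarrow> a = 0)"
    and a6: "\<And>a b c i j k l. 1 \<le> i \<Longrightarrow> i \<le> j \<Longrightarrow> j \<le> k \<Longrightarrow> k \<le> l \<Longrightarrow> l \<le> r \<Longrightarrow>
      mul (component r A a i j) (mul (component r A b j k) (component r A c k l)) =
      mul (mul (component r A a i j) (component r A b j k)) (component r A c k l)"
    and a7: "\<And>a b i j k l. 1 \<le> i \<Longrightarrow> i \<le> j \<Longrightarrow> j \<le> k \<Longrightarrow> k \<le> r \<Longrightarrow> 1 \<le> l \<Longrightarrow> l \<le> k \<Longrightarrow>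
      mul (component r A a i j) (mul (component r A b j k) (star (component r A b l k))) =
      mul (mul (component r A a i j) (component r A b j k)) (star (component r A b l k))"

definition upper_triangular ::
  "nat \<Rightarrow> (nat \<Rightarrow> nat \<Rightarrow> 'a::euclidean_space set) \<Rightarrow> 'a set" where
  "upper_triangular r A =
     {t. \<forall>i\<in>{1..r}. \<forall>j\<in>{1..r}. j < i \<longrightarrow> component r A t i j = 0}"

definition upper_triangular_pos ::
  "nat \<Rightarrow> (nat \<Rightarrow> nat \<Rightarrow> 'a::euclidean_space set) \<Rightarrow> (nat \<Rightarrow> 'a \<Rightarrow> real) \<Rightarrow> 'a set" where
  "upper_triangular_pos r A \<rho> =
     {t \<in> upper_triangular r A. \<forall>i\<in>{1..r}. \<rho> i (component r A t i i) > 0}"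

definition T_cone ::
  "nat \<Rightarrow> (nat \<Rightarrow> nat \<Rightarrow> 'a::euclidean_space set) \<Rightarrow> ('a \<Rightarrow> 'a \<Rightarrow> 'a) \<Rightarrow> ('a \<Rightarrow> 'a) \<Rightarrow>
   (nat \<Rightarrow> 'a \<Rightarrow> real) \<Rightarrow> 'a set" where
  "T_cone r A mul star \<rho> = {mul t (star t) | t. t \<in> upper_triangular_pos r A \<rho>}"

text \<open>
  Cones are closed under multiplication by positive scalars and need not contain 0 (as \<open>T_cone\<close>
  does not), unlike for \<^const>\<open>convex_cone\<close>. Faces are nonempty, unlike for \<^const>\<open>face_of\<close>.
\<close>

definition cone_face :: "'a::real_vector set \<Rightarrow> 'a set \<Rightarrow> bool" where
  "cone_face K F \<longleftrightarrow>
     F \<noteq> {} \<and> F \<subseteq> K \<and> convex F \<and> (\<forall>x\<in>F. \<forall>c>0. c *\<^sub>R x \<in> F) \<and>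
     (\<forall>x\<in>K. \<forall>y\<in>K. x + y \<in> F \<longrightarrow> x \<in> F \<and> y \<in> F)"

definition face_chain :: "'a::real_vector set \<Rightarrow> 'a set list \<Rightarrow> bool" where
  "face_chain K Fs \<longleftrightarrow> (\<forall>F\<in>set Fs. cone_face K F) \<and> sorted_wrt (\<subset>) Fs"

definition longest_face_chain_length :: "'a::real_vector set \<Rightarrow> nat \<Rightarrow> bool" where
  "longest_face_chain_length K n \<longleftrightarrow>
     (\<exists>Fs. face_chain K Fs \<and> length Fs = n) \<and>
     (\<forall>Fs. face_chain K Fs \<longrightarrow> length Fs \<le> n)"

end

theory Submission
  imports Defs
begin

text \<open>
  The closed cone is built up from \<open>{0}\<close> in \<open>r\<close> steps, each of which adds one row and one column, and
  each step makes the longest chain of faces longer by exactly one; \<open>{0}\<close> itself has one face.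

  A step has the following shape. Let \<open>K\<close> be a pointed convex cone and \<open>Q\<close> a quadratic map with values
  in \<open>K\<close> that vanishes only at 0. The extension of \<open>K\<close> by \<open>Q\<close> consists of the \<open>(x, u, s)\<close> with
  \<open>x \<in> K\<close>, \<open>s \<ge> 0\<close> and \<open>s x - Q(u) \<in> K\<close>; for \<open>s > 0\<close> this says that the Schur complement
  \<open>x - Q(u) / s\<close> lies in \<open>K\<close>, and for \<open>s = 0\<close> it forces \<open>u = 0\<close>. So the points of height \<open>s = 0\<close> form
  a copy of \<open>K\<close>, and intersecting a face with this copy gives a face of \<open>K\<close>, its bottom.
  A face of height 0 is determined by its bottom. Two nested faces that both reach positive height and
  have equal bottoms are equal as well (\<open>face_eq_if_bottom_eq\<close>): the smaller one contains a
  point \<open>p\<close> of positive height with Schur complement 0. A point of the larger face has a mirror image with respect to \<open>p\<close> in the cone, and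
  the sum of the two is a point of the bottom plus a multiple of \<open>p\<close>, hence is in the smaller face.
  Hence replacing the faces of a chain by their bottoms can identify only the last
  face of height 0 with the first one of positive height, which bounds the chains of the extension
  by one more than those of \<open>K\<close>; the whole extension on top of a chain of \<open>K\<close> attains the bound
  (\<open>longest_face_chain_length_extension\<close>).

  In a T-algebra, \<open>Q(u) = u u\<^sup>*\<close> for a column vector \<open>u\<close>, and \<open>(x, u, s)\<close> is the Hermitian element with
  upper left corner \<open>x\<close>, last column \<open>u\<close> and last diagonal entry \<open>s\<close>. What has to be shown is that
  \<open>Q\<close> takes values in the cone of the smaller corner. This is \<open>column_square_in_corner_cone\<close>, where the
  partial associativity \<open>a7\<close> and the positivity \<open>a5\<close> enter. Finally, the element \<open>t t\<^sup>*\<close> with \<open>t\<close>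
  triangular decomposes in the same recursive way (a Cholesky decomposition), so the cone
  obtained after \<open>r\<close> steps is the closure of the cone of the statement (\<open>closure_T_cone\<close>).
\<close>

section \<open>Chains of faces\<close>

lemma cone_face_self:
  assumes "convex_cone K"
  shows "cone_face K K"
  using assms by (auto simp: cone_face_def convex_cone_def conic_def)

lemma zero_in_cone_face:
  assumes "convex_cone K" "cone_face K F"
  shows "0 \<in> F"
proof -
  obtain x where "x \<in> F" using assms(2) by (auto simp: cone_face_def)
  moreover have "0 \<in> K" "x \<in> K"
    using assms \<open>x \<in> F\<close> convex_cone_contains_0 by (auto simp: cone_face_def)
  ultimately show ?thesis
    using assms(2) unfolding cone_face_def by (metis add_0)
qed

lemma cone_face_add:
  assumes "cone_face K F" "x \<in> F" "y \<in> F"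
  shows "x + y \<in> F"
proof -
  have "(1/2) *\<^sub>R x + (1/2) *\<^sub>R y \<in> F"
    using assms by (auto simp: cone_face_def intro!: convexD)
  then have "2 *\<^sub>R ((1/2) *\<^sub>R x + (1/2) *\<^sub>R y) \<in> F"
    using assms(1) unfolding cone_face_def by (meson zero_less_numeral)
  then show ?thesis by (simp add: scaleR_add_right)
qed

lemma cone_face_scaleR:
  assumes "cone_face K F" "x \<in> F" "c > 0"
  shows "c *\<^sub>R x \<in> F"
  using assms by (auto simp: cone_face_def)

lemma cone_face_scaleR_iff:
  assumes "cone_face K F" "c > 0"
  shows "c *\<^sub>R x \<in> F \<longleftrightarrow> x \<in> F"
  using cone_face_scaleR[OF assms(1), of x c] cone_face_scaleR[OF assms(1), of "c *\<^sub>R x" "inverse c"] assms(2)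
  by auto

lemma cone_face_split:
  assumes "cone_face K F" "x + y \<in> F" "x \<in> K" "y \<in> K"
  shows "x \<in> F" "y \<in> F"
  using assms unfolding cone_face_def by blast+

lemma cone_face_linear_vimage:
  assumes "linear f" "cone_face (f ` K) F" "convex_cone K"
  shows "cone_face K (K \<inter> f -` F)"
proof -
  interpret f: linear f by fact
  have "convex (K \<inter> f -` F)"
    using assms by (intro convex_Int convex_linear_vimage) (auto simp: cone_face_def convex_cone_def)
  moreover have "F \<noteq> {}" "F \<subseteq> f ` K" using assms(2) by (auto simp: cone_face_def)
  then have "K \<inter> f -` F \<noteq> {}" by blast
  ultimately show ?thesis
    using assms(2,3) by (auto simp: cone_face_def f.scaleR f.add convex_cone_scaleR)
qed

lemma cone_face_linear_image:
  assumes "linear f" "inj_on f K" "cone_face K F" "convex_cone K"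
  shows "cone_face (f ` K) (f ` F)"
proof -
  interpret f: linear f by fact
  have "convex (f ` F)" "f ` F \<noteq> {}" "f ` F \<subseteq> f ` K" "F \<subseteq> K"
    using assms by (auto simp: cone_face_def intro: convex_linear_image)
  moreover have "\<forall>x\<in>f ` F. \<forall>c>0. c *\<^sub>R x \<in> f ` F"
    using assms(3) by (auto simp flip: f.scaleR simp: cone_face_def)
  moreover have "f x \<in> f ` F \<and> f y \<in> f ` F" if "x \<in> K" "y \<in> K" "f x + f y \<in> f ` F" for x y
  proof -
    have "x + y \<in> K" using that assms(4) by (auto intro: convex_cone_add)
    then have "x + y \<in> F"
      using that assms(2) \<open>F \<subseteq> K\<close> by (auto simp flip: f.add simp: inj_on_image_mem_iff)
    then show ?thesis using that assms(3) by (auto simp: cone_face_def)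
  qed
  ultimately show ?thesis unfolding cone_face_def by blast
qed

lemma sorted_wrt_psubset_map:
  assumes "sorted_wrt (\<subset>) Fs"
    and "\<And>F G. F \<in> set Fs \<Longrightarrow> G \<in> set Fs \<Longrightarrow> F \<subset> G \<Longrightarrow> g F \<subset> g G"
  shows "sorted_wrt (\<subset>) (map g Fs)"
  using assms by (induction Fs) auto

lemma face_chain_map:
  assumes "face_chain K Fs"
    and "\<And>F. cone_face K F \<Longrightarrow> cone_face L (g F)"
    and "\<And>F G. cone_face K F \<Longrightarrow> cone_face K G \<Longrightarrow> F \<subset> G \<Longrightarrow> g F \<subset> g G"
  shows "face_chain L (map g Fs)"
  unfolding face_chain_def
proof
  show "sorted_wrt (\<subset>) (map g Fs)"
    using assms(1,3) by (intro sorted_wrt_psubset_map) (simp_all add: face_chain_def)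
qed (use assms in \<open>auto simp: face_chain_def\<close>)

lemma longest_face_chain_length_linear_image:
  assumes "linear f" "inj_on f K" "convex_cone K" "longest_face_chain_length K n"
  shows "longest_face_chain_length (f ` K) n"
  unfolding longest_face_chain_length_def
proof (intro conjI allI impI)
  obtain Fs where Fs: "face_chain K Fs" "length Fs = n"
    using assms(4) by (auto simp: longest_face_chain_length_def)
  have "face_chain (f ` K) (map ((`) f) Fs)"
  proof (rule face_chain_map[OF Fs(1)])
    fix F G assume FG: "cone_face K F" "cone_face K G" "F \<subset> G"
    then have "F \<subseteq> K" "G \<subseteq> K" by (auto simp: cone_face_def)
    then show "f ` F \<subset> f ` G"
      using FG(3) inj_on_image_eq_iff[OF assms(2), of F G] by blast
  qed (use assms cone_face_linear_image in blast)
  then show "\<exists>Fs. face_chain (f ` K) Fs \<and> length Fs = n"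
    using Fs(2) by (intro exI[of _ "map ((`) f) Fs"]) simp
next
  fix Fs assume Fs: "face_chain (f ` K) Fs"
  have "face_chain K (map (\<lambda>F. K \<inter> f -` F) Fs)"
  proof (rule face_chain_map[OF Fs])
    fix F G assume FG: "cone_face (f ` K) F" "cone_face (f ` K) G" "F \<subset> G"
    then obtain y where "y \<in> G" "y \<notin> F" by auto
    moreover from this obtain x where "x \<in> K" "y = f x" using FG(2) by (auto simp: cone_face_def)
    ultimately show "K \<inter> f -` F \<subset> K \<inter> f -` G" using FG(3) by blast
  qed (use assms cone_face_linear_vimage in blast)
  then have "length (map (\<lambda>F. K \<inter> f -` F) Fs) \<le> n"
    using assms(4) by (simp only: longest_face_chain_length_def)
  then show "length Fs \<le> n" by simp
qed

lemma longest_face_chain_length_zero: "longest_face_chain_length {0::'a::real_vector} 1"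
  unfolding longest_face_chain_length_def
proof (intro conjI allI impI)
  have "cone_face {0::'a} {0}" by (auto simp: cone_face_def)
  then show "\<exists>Fs. face_chain {0::'a} Fs \<and> length Fs = 1"
    by (intro exI[of _ "[{0}]"]) (simp add: face_chain_def)
next
  fix Fs assume Fs: "face_chain {0::'a} Fs"
  have F0: "F = {0}" if "F \<in> set Fs" for F
    using Fs that by (auto simp: face_chain_def cone_face_def subset_singleton_iff)
  show "length Fs \<le> 1"
  proof (rule ccontr)
    assume "\<not> length Fs \<le> 1"
    then have len: "0 < length Fs" "1 < length Fs" by auto
    then have "Fs ! 0 \<subset> Fs ! 1"
      using Fs by (simp add: face_chain_def sorted_wrt_iff_nth_less)
    then show False using F0[OF nth_mem[OF len(1)]] F0[OF nth_mem[OF len(2)]] by simp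
  qed
qed

section \<open>Extending a cone by a positive quadratic map\<close>

text \<open>
  If \<open>K\<close> is the cone of positive semidefinite \<open>n\<close> by \<open>n\<close> matrices and \<open>Q u v\<close> the symmetric
  part of \<open>u v\<^sup>T\<close>, this is the cone of positive semidefinite matrices of size \<open>n + 1\<close>. Writing the
  Schur complement condition without a division makes it a closed condition.
\<close>

definition quadratic_extension ::
  "'a::real_vector set \<Rightarrow> 'b::real_vector set \<Rightarrow> ('b \<Rightarrow> 'b \<Rightarrow> 'a) \<Rightarrow> ('a \<times> 'b \<times> real) set" where
  "quadratic_extension K U Q = {(x, u, s). x \<in> K \<and> u \<in> U \<and> 0 \<le> s \<and> s *\<^sub>R x - Q u u \<in> K}"

lemma closed_quadratic_extension:
  fixes K :: "'a::euclidean_space set" and U :: "'b::euclidean_space set"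
  assumes "closed K" "subspace U" "bilinear Q"
  shows "closed (quadratic_extension K U Q)"
proof -
  have "bounded_bilinear Q" using assms(3) by (simp add: bilinear_conv_bounded_bilinear)
  then have Q: "continuous_on UNIV (\<lambda>z::'a \<times> 'b \<times> real. Q (fst (snd z)) (fst (snd z)))"
    by (rule bounded_bilinear.continuous_on) (intro continuous_intros)+
  have "closed U" using assms(2) by (rule closed_subspace)
  have "quadratic_extension K U Q = fst -` K \<inter> (\<lambda>z. fst (snd z)) -` U \<inter> (\<lambda>z. snd (snd z)) -` {0..}
      \<inter> (\<lambda>z. snd (snd z) *\<^sub>R fst z - Q (fst (snd z)) (fst (snd z))) -` K"
    by (auto simp: quadratic_extension_def)
  also have "closed \<dots>"
    using assms(1) \<open>closed U\<close> Q by (intro closed_Int closed_vimage closed_atLeast continuous_intros)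
  finally show ?thesis .
qed

locale positive_quadratic_map =
  fixes K :: "'a::real_vector set" and U :: "'b::real_vector set" and Q :: "'b \<Rightarrow> 'b \<Rightarrow> 'a"
  assumes cone_K: "convex_cone K"
    and pointed_K: "x \<in> K \<Longrightarrow> - x \<in> K \<Longrightarrow> x = 0"
    and subspace_U: "subspace U"
    and bilinear_Q: "bilinear Q"
    and sym_Q: "Q u v = Q v u"
    and Q_in: "u \<in> U \<Longrightarrow> Q u u \<in> K"
    and Q_eq_0: "u \<in> U \<Longrightarrow> Q u u = 0 \<Longrightarrow> u = 0"
begin

abbreviation extension :: "('a \<times> 'b \<times> real) set" where
  "extension \<equiv> quadratic_extension K U Q"

lemmas Q_simps = bilinear_ladd[OF bilinear_Q] bilinear_radd[OF bilinear_Q]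
  bilinear_lsub[OF bilinear_Q] bilinear_rsub[OF bilinear_Q]
  bilinear_lmul[OF bilinear_Q] bilinear_rmul[OF bilinear_Q]
  bilinear_lneg[OF bilinear_Q] bilinear_rneg[OF bilinear_Q]
  bilinear_lzero[OF bilinear_Q] bilinear_rzero[OF bilinear_Q]

lemma scaleR_in_K_iff: "c > 0 \<Longrightarrow> c *\<^sub>R x \<in> K \<longleftrightarrow> x \<in> K"
  using convex_cone_scaleR[OF cone_K, of c x] convex_cone_scaleR[OF cone_K, of "inverse c" "c *\<^sub>R x"]
  by auto

lemma zero_in_K: "0 \<in> K"
  using cone_K by (rule convex_cone_contains_0)

text \<open>
  At height 0 the condition reads \<open>- Q u u \<in> K\<close>, and \<open>Q u u \<in> K\<close> by positivity.
\<close>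

lemma extension_zero_height_iff: "(x, u, 0) \<in> extension \<longleftrightarrow> x \<in> K \<and> u = 0"
proof
  assume "(x, u, 0) \<in> extension"
  then have "x \<in> K" "u \<in> U" "- Q u u \<in> K" by (auto simp: quadratic_extension_def)
  then show "x \<in> K \<and> u = 0" using Q_in pointed_K Q_eq_0 by blast
qed (auto simp: quadratic_extension_def Q_simps zero_in_K subspace_0[OF subspace_U])

lemma extension_pos_height_iff:
  assumes "s > 0"
  shows "(x, u, s) \<in> extension \<longleftrightarrow> u \<in> U \<and> s *\<^sub>R x - Q u u \<in> K"
proof -
  have "x \<in> K" if "u \<in> U" "s *\<^sub>R x - Q u u \<in> K"
    using convex_cone_add[OF cone_K that(2) Q_in[OF that(1)]] scaleR_in_K_iff[OF assms] by simp
  then show ?thesis using assms by (auto simp: quadratic_extension_def)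
qed

lemma extension_height_cases:
  assumes "(x, u, s) \<in> extension"
  obtains "s = 0" "u = 0" "x \<in> K" | "s > 0" "u \<in> U" "s *\<^sub>R x - Q u u \<in> K"
  using assms extension_zero_height_iff[of x u] by (cases "s = 0") (auto simp: quadratic_extension_def)

text \<open>
  The map \<open>(u, s) \<mapsto> Q(u) / s\<close> is convex with respect to the order of \<open>K\<close>: the difference
  \<open>Q(u) / s + Q(u') / s' - Q(u + u') / (s + s')\<close> is a positive multiple of \<open>Q(s' u - s u')\<close>. The proof
  uses this identity multiplied by \<open>s s' (s + s')\<close>.
\<close>

lemma convex_cone_extension: "convex_cone extension"
  unfolding convex_cone_iff
proof (intro conjI ballI allI impI)
  show "0 \<in> extension"
    by (simp add: zero_prod_def extension_zero_height_iff zero_in_K)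
next
  fix c :: real and z assume "z \<in> extension" "0 \<le> c"
  then obtain x u s where z: "z = (x, u, s)" "x \<in> K" "u \<in> U" "0 \<le> s" "s *\<^sub>R x - Q u u \<in> K"
    by (cases z) (auto simp: quadratic_extension_def)
  have "(c * s) *\<^sub>R (c *\<^sub>R x) - Q (c *\<^sub>R u) (c *\<^sub>R u) = (c * c) *\<^sub>R (s *\<^sub>R x - Q u u)"
    by (simp add: Q_simps algebra_simps)
  then show "c *\<^sub>R z \<in> extension"
    using z \<open>0 \<le> c\<close> subspace_U by (auto simp: quadratic_extension_def convex_cone_scaleR[OF cone_K] subspace_scale)
next
  fix z z' assume *: "z \<in> extension" "z' \<in> extension"
  obtain x u s x' u' s' where z: "z = (x, u, s)" "z' = (x', u', s')"
    by (cases z rule: prod_cases3, cases z' rule: prod_cases3) blast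
  have K: "x + x' \<in> K" "u + u' \<in> U" "0 \<le> s + s'"
    using * subspace_U by (auto simp: z quadratic_extension_def intro: convex_cone_add[OF cone_K] subspace_add)
  have "(s + s') *\<^sub>R (x + x') - Q (u + u') (u + u') \<in> K"
    using *(1)[unfolded z]
  proof (cases rule: extension_height_cases)
    case 1
    then have "s' *\<^sub>R x + (s' *\<^sub>R x' - Q u' u') \<in> K"
      using *(2) by (intro convex_cone_add[OF cone_K] convex_cone_scaleR[OF cone_K]) (auto simp: z quadratic_extension_def)
    with 1 show ?thesis by (simp add: algebra_simps)
  next
    case s: 2
    show ?thesis
      using *(2)[unfolded z]
    proof (cases rule: extension_height_cases)
      case 1
      then have "s *\<^sub>R x' + (s *\<^sub>R x - Q u u) \<in> K"
        using s by (intro convex_cone_add[OF cone_K] convex_cone_scaleR[OF cone_K]) auto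
      with 1 show ?thesis by (simp add: algebra_simps)
    next
      case s': 2
      have "s' *\<^sub>R u - s *\<^sub>R u' \<in> U"
        using s s' subspace_U by (simp add: subspace_diff subspace_scale)
      then have "(s' * (s + s')) *\<^sub>R (s *\<^sub>R x - Q u u) + (s * (s + s')) *\<^sub>R (s' *\<^sub>R x' - Q u' u')
          + Q (s' *\<^sub>R u - s *\<^sub>R u') (s' *\<^sub>R u - s *\<^sub>R u') \<in> K"
        using s s' by (intro convex_cone_add[OF cone_K] convex_cone_scaleR[OF cone_K] Q_in) auto
      also have "(s' * (s + s')) *\<^sub>R (s *\<^sub>R x - Q u u) + (s * (s + s')) *\<^sub>R (s' *\<^sub>R x' - Q u' u')
          + Q (s' *\<^sub>R u - s *\<^sub>R u') (s' *\<^sub>R u - s *\<^sub>R u') = (s * s') *\<^sub>R ((s + s') *\<^sub>R (x + x') - Q (u + u') (u + u'))"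
        by (simp add: Q_simps sym_Q[of u' u] algebra_simps)
      finally show ?thesis using s s' scaleR_in_K_iff by simp
    qed
  qed
  then show "z + z' \<in> extension" using K by (simp add: z quadratic_extension_def)
qed

lemma pointed_extension:
  assumes "z \<in> extension" "- z \<in> extension"
  shows "z = 0"
proof -
  obtain x u s where z: "z = (x, u, s)" by (cases z rule: prod_cases3)
  then have "s = 0" using assms by (auto simp: quadratic_extension_def)
  then show ?thesis
    using assms extension_zero_height_iff[of x u] extension_zero_height_iff[of "- x" "- u"] pointed_K
    by (auto simp: z zero_prod_def)
qed

definition bottom :: "('a \<times> 'b \<times> real) set \<Rightarrow> 'a set" where
  "bottom F = {x. (x, 0, 0) \<in> F}"

lemma cone_face_bottom:
  assumes "cone_face extension F"
  shows "cone_face K (bottom F)"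
proof -
  have "linear (\<lambda>x::'a. (x, 0::'b, 0::real))" by (auto intro!: linearI)
  moreover have "bottom F = (\<lambda>x. (x, 0, 0)) -` F" by (auto simp: bottom_def)
  ultimately have "convex (bottom F)"
    using assms by (auto simp: cone_face_def intro: convex_linear_vimage)
  moreover have "0 \<in> bottom F"
    using zero_in_cone_face[OF convex_cone_extension assms] by (simp add: bottom_def zero_prod_def)
  moreover have "bottom F \<subseteq> K"
    using assms by (auto simp: bottom_def cone_face_def quadratic_extension_def)
  moreover have "c *\<^sub>R x \<in> bottom F" if "x \<in> bottom F" "c > 0" for c x
    using cone_face_scaleR[OF assms, of "(x, 0, 0)" c] that by (simp add: bottom_def)
  moreover have "x \<in> bottom F \<and> y \<in> bottom F" if "x \<in> K" "y \<in> K" "x + y \<in> bottom F" for x y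
    using cone_face_split[OF assms, of "(x, 0, 0)" "(y, 0, 0)"] that
    by (simp add: bottom_def extension_zero_height_iff)
  ultimately show ?thesis unfolding cone_face_def by blast
qed

lemma cone_face_embed:
  assumes "cone_face K G"
  shows "cone_face extension ((\<lambda>x. (x, 0, 0)) ` G)"
proof -
  have lin: "linear (\<lambda>x::'a. (x, 0::'b, 0::real))" by (auto intro!: linearI)
  have "z \<in> (\<lambda>x. (x, 0, 0)) ` G \<and> z' \<in> (\<lambda>x. (x, 0, 0)) ` G"
    if "z \<in> extension" "z' \<in> extension" "z + z' \<in> (\<lambda>x. (x, 0, 0)) ` G" for z z'
  proof -
    obtain x u s x' u' s' where z: "z = (x, u, s)" "z' = (x', u', s')"
    by (cases z rule: prod_cases3, cases z' rule: prod_cases3) blast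
    with that have "s = 0" "s' = 0" "x + x' \<in> G" by (auto simp: quadratic_extension_def)
    moreover from this that have "u = 0" "u' = 0" "x \<in> K" "x' \<in> K"
      by (auto simp: z extension_zero_height_iff)
    ultimately show ?thesis using assms by (auto simp: z cone_face_def)
  qed
  then show ?thesis
    using assms convex_linear_image[OF lin, of G]
    by (auto simp: cone_face_def extension_zero_height_iff)
qed

text \<open>
  A point of positive height is the sum of its Schur complement, at height 0, and of a point with
  Schur complement 0. A face contains both summands. They are stated after multiplication by \<open>s\<close>.
\<close>

lemma complement_in_bottom:
  assumes F: "cone_face extension F" and z: "(y, v, s) \<in> F" and "s > 0"
  shows "s *\<^sub>R y - Q v v \<in> bottom F" "(Q v v, s *\<^sub>R v, s * s) \<in> F"
proof -
  have "(y, v, s) \<in> extension" using F z by (auto simp: cone_face_def)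
  then have v: "v \<in> U" "s *\<^sub>R y - Q v v \<in> K" using \<open>s > 0\<close> extension_pos_height_iff by auto
  have "s *\<^sub>R (y, v, s) \<in> F" by (rule cone_face_scaleR[OF F z \<open>s > 0\<close>])
  then have "(s *\<^sub>R y - Q v v, 0, 0) + (Q v v, s *\<^sub>R v, s * s) \<in> F" by simp
  moreover have "(Q v v, s *\<^sub>R v, s * s) \<in> extension"
    using v \<open>s > 0\<close> subspace_U
    by (simp add: extension_pos_height_iff Q_simps zero_in_K subspace_scale)
  ultimately show "s *\<^sub>R y - Q v v \<in> bottom F" "(Q v v, s *\<^sub>R v, s * s) \<in> F"
    using cone_face_split[OF F, of "(s *\<^sub>R y - Q v v, 0, 0)" "(Q v v, s *\<^sub>R v, s * s)"] v(2)
    by (simp_all add: bottom_def extension_zero_height_iff)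
qed

text \<open>
  Let \<open>(Q p p, p, 1)\<close> be a point of \<open>F\<close> with Schur complement 0. The shear
  \<open>(y, v, s) \<mapsto> (y - 2 Q v p + s Q p p, v - s p, s)\<close> maps the extension to itself, fixes the points of
  height 0 and moves this point to \<open>(0, 0, 1)\<close>. In sheared coordinates a point \<open>(g, w, s)\<close> of \<open>G\<close> has the mirror
  image \<open>(g, - w, s)\<close> in the cone, and the sum of the two is \<open>2 (g, 0, s)\<close>, which lies in \<open>F\<close> as soon as
  \<open>g\<close> lies in the bottom of \<open>F\<close>; then the face \<open>F\<close> contains both summands. The proof carries out this
  argument in the original coordinates.
\<close>

lemma face_eq_if_bottom_eq:
  assumes F: "cone_face extension F" and G: "cone_face extension G"
    and "F \<subseteq> G" and high: "(x, u, t) \<in> F" "t > 0" and bottom: "bottom G \<subseteq> bottom F"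
  shows "F = G"
proof
  define p where "p = u /\<^sub>R t"
  have "(x, u, t) \<in> extension" using F high by (auto simp: cone_face_def)
  then have pU: "p \<in> U"
    using subspace_U by (auto simp: p_def quadratic_extension_def subspace_scale)
  have "inverse (t * t) *\<^sub>R (Q u u, t *\<^sub>R u, t * t) \<in> F"
    using complement_in_bottom(2)[OF F high] \<open>t > 0\<close> by (intro cone_face_scaleR[OF F]) auto
  moreover have "inverse (t * t) *\<^sub>R (Q u u, t *\<^sub>R u, t * t) = (Q p p, p, 1)"
    using \<open>t > 0\<close> by (simp add: p_def Q_simps) (simp add: field_simps)
  ultimately have pF: "(Q p p, p, 1) \<in> F" by simp
  show "G \<subseteq> F"
  proof
    fix z assume zG: "z \<in> G"
    obtain y v s where z: "z = (y, v, s)" by (cases z rule: prod_cases3)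
    have zK: "(y, v, s) \<in> extension" using G zG by (auto simp: z cone_face_def)
    then show "z \<in> F"
    proof (cases rule: extension_height_cases)
      case 1
      then show ?thesis using bottom zG by (auto simp: z bottom_def)
    next
      case 2
      \<comment> \<open>The midpoint of the two points with Schur complement 0 over \<open>v / s\<close> and \<open>p\<close> has a
        multiple of \<open>Q (v - s p)\<close> as its Schur complement, which thus lies in the bottom of \<open>G\<close>.\<close>
      have zG': "(Q v v, s *\<^sub>R v, s * s) \<in> G" "s *\<^sub>R y - Q v v \<in> bottom G"
        using complement_in_bottom[OF G, of y v s] zG 2 by (auto simp: z)
      have "(s * s) *\<^sub>R (Q p p, p, 1) \<in> G"
        using pF \<open>F \<subseteq> G\<close> 2 by (intro cone_face_scaleR[OF G]) auto
      with zG'(1) have "(Q v v, s *\<^sub>R v, s * s) + (s * s) *\<^sub>R (Q p p, p, 1) \<in> G"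
        by (rule cone_face_add[OF G])
      then have "(Q v v + (s * s) *\<^sub>R Q p p, s *\<^sub>R v + (s * s) *\<^sub>R p, 2 * (s * s)) \<in> G"
        by simp
      then have "(2 * (s * s)) *\<^sub>R (Q v v + (s * s) *\<^sub>R Q p p)
          - Q (s *\<^sub>R v + (s * s) *\<^sub>R p) (s *\<^sub>R v + (s * s) *\<^sub>R p) \<in> bottom G"
        using 2 by (intro complement_in_bottom(1)[OF G]) auto
      also have "(2 * (s * s)) *\<^sub>R (Q v v + (s * s) *\<^sub>R Q p p)
          - Q (s *\<^sub>R v + (s * s) *\<^sub>R p) (s *\<^sub>R v + (s * s) *\<^sub>R p)
          = (s * s) *\<^sub>R Q (v - s *\<^sub>R p) (v - s *\<^sub>R p)"
        by (simp add: Q_simps sym_Q[of p v] algebra_simps flip: scaleR_2)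
      finally have "Q (v - s *\<^sub>R p) (v - s *\<^sub>R p) \<in> bottom G"
        using 2 cone_face_scaleR_iff[OF cone_face_bottom[OF G], of "s * s"] by simp
      with zG'(2) have "s *\<^sub>R y - Q v v + Q (v - s *\<^sub>R p) (v - s *\<^sub>R p) \<in> bottom F"
        using bottom by (intro subsetD[OF bottom] cone_face_add[OF cone_face_bottom[OF G]])
      \<comment> \<open>The corner entry of \<open>z\<close> after the shear.\<close>
      define g where "g = y - Q v p - Q v p + s *\<^sub>R Q p p"
      have "s *\<^sub>R y - Q v v + Q (v - s *\<^sub>R p) (v - s *\<^sub>R p) = s *\<^sub>R g"
        by (simp add: g_def Q_simps sym_Q[of p v] algebra_simps)
      then have "g \<in> bottom F"
        using 2 \<open>_ \<in> bottom F\<close> cone_face_scaleR_iff[OF cone_face_bottom[OF F], of s] by simp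
      then have "(g, 0, 0) \<in> F" by (simp add: bottom_def)
      then have m: "(g, 0, 0) + s *\<^sub>R (Q p p, p, 1) \<in> F" (is "?m \<in> F")
        using pF 2 by (intro cone_face_add[OF F] cone_face_scaleR[OF F])
      have "?m + ?m \<in> F" by (rule cone_face_add[OF F m m])
      \<comment> \<open>The mirror image of \<open>z\<close>; it has the same height and the same Schur complement.\<close>
      moreover define z' where
        "z' = (g + s *\<^sub>R Q p p + (g + s *\<^sub>R Q p p) - y, s *\<^sub>R p + s *\<^sub>R p - v, s)"
      have "z + z' = ?m + ?m" by (simp add: z z'_def)
      moreover have "s *\<^sub>R (g + s *\<^sub>R Q p p + (g + s *\<^sub>R Q p p) - y)
          - Q (s *\<^sub>R p + s *\<^sub>R p - v) (s *\<^sub>R p + s *\<^sub>R p - v) = s *\<^sub>R y - Q v v"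
        by (simp add: g_def Q_simps sym_Q[of p v] algebra_simps)
      then have "z' \<in> extension"
        using 2 pU subspace_U
        by (simp add: z'_def extension_pos_height_iff subspace_diff subspace_add subspace_scale)
      ultimately show ?thesis using cone_face_split(1)[OF F, of z z'] zK by (simp add: z)
    qed
  qed
qed fact

text \<open>
  In a chain, the faces of height 0 come before those of positive height. Taking bottoms is
  injective on either part, so after dropping the first face of positive height the bottoms
  form a chain of faces of \<open>K\<close>.
\<close>

theorem longest_face_chain_length_extension:
  assumes n: "longest_face_chain_length K n"
  shows "longest_face_chain_length extension (n + 1)"
  unfolding longest_face_chain_length_def
proof (intro conjI allI impI)
  obtain Gs where Gs: "face_chain K Gs" "length Gs = n"
    using n by (auto simp: longest_face_chain_length_def)
  let ?emb = "\<lambda>G. (\<lambda>x. (x, 0::'b, 0::real)) ` G"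
  have inj: "inj (\<lambda>x::'a. (x, 0::'b, 0::real))" by (rule injI) simp
  have "face_chain extension (map ?emb Gs)"
  proof (rule face_chain_map[OF Gs(1) cone_face_embed])
    fix F G :: "'a set" assume "F \<subset> G"
    then show "?emb F \<subset> ?emb G" using inj_image_eq_iff[OF inj, of F G] by blast
  qed
  moreover have "?emb G \<subset> extension" if "G \<in> set Gs" for G
  proof
    show "?emb G \<subseteq> extension"
      using calculation that by (auto simp: face_chain_def cone_face_def)
    have "(0, 0, 1) \<in> extension"
      using subspace_U by (simp add: quadratic_extension_def Q_simps zero_in_K subspace_0)
    moreover have "(0, 0, 1) \<notin> ?emb G" by auto
    ultimately show "?emb G \<noteq> extension" by blast
  qed
  ultimately have "face_chain extension (map ?emb Gs @ [extension])"
    using cone_face_self[OF convex_cone_extension] by (auto simp: face_chain_def sorted_wrt_append)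
  then show "\<exists>Fs. face_chain extension Fs \<and> length Fs = n + 1"
    using Gs(2) by (intro exI[of _ "map ?emb Gs @ [extension]"]) simp
next
  fix Fs assume Fs: "face_chain extension Fs"
  define low :: "('a \<times> 'b \<times> real) set \<Rightarrow> bool" where "low F \<longleftrightarrow> (\<forall>(x, u, s)\<in>F. s = 0)" for F
  define ls hs where "ls = takeWhile low Fs" and "hs = dropWhile low Fs"
  have Fs_eq: "Fs = ls @ hs" by (simp add: ls_def hs_def)
  have faces: "\<forall>F\<in>set ls. cone_face extension F" "\<forall>F\<in>set hs. cone_face extension F"
    and sorted: "sorted_wrt (\<subset>) ls" "sorted_wrt (\<subset>) hs"
    and ls_hs: "\<And>F H. F \<in> set ls \<Longrightarrow> H \<in> set hs \<Longrightarrow> F \<subset> H"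
    using Fs by (auto simp: face_chain_def Fs_eq sorted_wrt_append)
  have mono: "bottom F \<subseteq> bottom G" if "F \<subseteq> G" for F G
    using that by (auto simp: bottom_def)
  have "bottom F \<subset> bottom G" if "F \<in> set ls" "G \<in> set ls" "F \<subset> G" for F G
  proof -
    have "low G" using that by (auto simp: ls_def dest: set_takeWhileD)
    obtain x u s where z: "(x, u, s) \<in> G" "(x, u, s) \<notin> F" using \<open>F \<subset> G\<close> by auto
    moreover have "s = 0" "(x, u, s) \<in> extension"
      using \<open>low G\<close> z faces that by (auto simp: low_def cone_face_def)
    ultimately show ?thesis
      using mono[of F G] that extension_zero_height_iff[of x u] by (auto simp: bottom_def)
  qed
  then have ls_chain: "sorted_wrt (\<subset>) (map bottom ls)"
    by (intro sorted_wrt_psubset_map sorted(1))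
  have high: "\<not> low H" if "H \<in> set hs" for H
  proof -
    have "hs \<noteq> []" using that by auto
    then have "\<not> low (hd hs)" unfolding hs_def by (rule hd_dropWhile)
    moreover have "hd hs \<subseteq> H"
      using sorted(2) that by (cases hs) auto
    ultimately show ?thesis unfolding low_def by blast
  qed
  have "bottom F \<subset> bottom G" if "F \<in> set hs" "G \<in> set hs" "F \<subset> G" for F G
  proof -
    have "\<not> low F" using high that by blast
    then obtain x u s where z: "(x, u, s) \<in> F" "s \<noteq> 0" by (auto simp: low_def)
    moreover have "(x, u, s) \<in> extension" using faces that z by (auto simp: cone_face_def)
    ultimately have "s > 0" by (auto simp: quadratic_extension_def)
    then have "\<not> bottom G \<subseteq> bottom F"
      using face_eq_if_bottom_eq[of F G x u s] faces that z by auto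
    then show ?thesis using mono[of F G] that by auto
  qed
  then have hs_chain: "sorted_wrt (\<subset>) (map bottom hs)"
    by (intro sorted_wrt_psubset_map sorted(2))
  have "bottom F \<subset> bottom H" if "F \<in> set ls" "H \<in> set (tl hs)" for F H
  proof (cases hs)
    case (Cons H0 hs')
    then have "bottom F \<subseteq> bottom H0" using that ls_hs by (intro mono) auto
    also have "bottom H0 \<subset> bottom H" using Cons that hs_chain by auto
    finally show ?thesis .
  qed (use that in auto)
  then have "face_chain K (map bottom (ls @ tl hs))"
    using faces ls_chain hs_chain
    by (cases hs) (auto simp: face_chain_def sorted_wrt_append intro!: cone_face_bottom)
  then have "length (map bottom (ls @ tl hs)) \<le> n"
    using n by (simp only: longest_face_chain_length_def)
  then show "length Fs \<le> n + 1" by (simp add: Fs_eq)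
qed

end

section \<open>Components\<close>

context matrix_algebra_with_involution
begin

abbreviation cmp :: "'a \<Rightarrow> nat \<Rightarrow> nat \<Rightarrow> 'a" where
  "cmp \<equiv> component r A"

lemma is_decomposition_cmp: "is_decomposition r A a (cmp a)"
  unfolding component_def by (rule theI'[OF direct_sum])

lemma cmp_eqI:
  assumes "\<And>i j. i \<in> {1..r} \<Longrightarrow> j \<in> {1..r} \<Longrightarrow> f i j \<in> A i j"
    and "\<And>i j. i \<notin> {1..r} \<or> j \<notin> {1..r} \<Longrightarrow> f i j = 0"
    and "(\<Sum>i\<in>{1..r}. \<Sum>j\<in>{1..r}. f i j) = a"
  shows "cmp a = f"
proof -
  have "is_decomposition r A a f"
    unfolding is_decomposition_def using assms by blast
  then show ?thesis using direct_sum is_decomposition_cmp by blast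
qed

lemma cmp_in: "i \<in> {1..r} \<Longrightarrow> j \<in> {1..r} \<Longrightarrow> cmp a i j \<in> A i j"
  and cmp_outside: "i \<notin> {1..r} \<or> j \<notin> {1..r} \<Longrightarrow> cmp a i j = 0"
  and sum_cmp: "(\<Sum>i\<in>{1..r}. \<Sum>j\<in>{1..r}. cmp a i j) = a"
  using is_decomposition_cmp[of a] by (simp_all add: is_decomposition_def)

lemma cmp_inject: "(\<And>i j. cmp a i j = cmp b i j) \<Longrightarrow> a = b"
  using sum_cmp[of a] sum_cmp[of b] by simp

lemma linear_cmp: "linear (\<lambda>a. cmp a i j)"
proof (rule linearI)
  fix a b and c :: real
  have "cmp (a + b) = (\<lambda>i j. cmp a i j + cmp b i j)"
    by (rule cmp_eqI)
      (simp_all only: cmp_outside sum.distrib sum_cmp subspace_add[OF subspace_A] cmp_in add_0)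
  then show "cmp (a + b) i j = cmp a i j + cmp b i j" by simp
  have "cmp (c *\<^sub>R a) = (\<lambda>i j. c *\<^sub>R cmp a i j)"
    by (rule cmp_eqI)
      (simp_all only: cmp_outside sum_cmp subspace_scale[OF subspace_A] cmp_in scaleR_zero_right
        flip: scaleR_sum_right)
  then show "cmp (c *\<^sub>R a) i j = c *\<^sub>R cmp a i j" by simp
qed

lemmas cmp_simps = linear_add[OF linear_cmp] linear_diff[OF linear_cmp] linear_neg[OF linear_cmp]
  linear_0[OF linear_cmp] linear_cmp[THEN linear_scale]

lemmas mul_simps = bilinear_ladd[OF bilinear_mul] bilinear_radd[OF bilinear_mul]
  bilinear_lsub[OF bilinear_mul] bilinear_rsub[OF bilinear_mul]
  bilinear_lmul[OF bilinear_mul] bilinear_rmul[OF bilinear_mul]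
  bilinear_lzero[OF bilinear_mul] bilinear_rzero[OF bilinear_mul]

lemmas star_simps = linear_add[OF linear_star] linear_diff[OF linear_star]
  linear_0[OF linear_star] linear_scale[OF linear_star] star_mul star_star

lemma cmp_homogeneous:
  assumes "i \<in> {1..r}" "j \<in> {1..r}" "a \<in> A i j"
  shows "cmp a k l = (if k = i \<and> l = j then a else 0)"
proof -
  have "cmp a = (\<lambda>k l. if k = i then if l = j then a else 0 else 0)"
  proof (rule cmp_eqI)
    have "(\<Sum>k\<in>{1..r}. \<Sum>l\<in>{1..r}. if k = i then if l = j then a else 0 else 0)
        = (\<Sum>k\<in>{1..r}. if k = i then a else 0)"
      using assms(2) by (intro sum.cong) auto
    then show "(\<Sum>k\<in>{1..r}. \<Sum>l\<in>{1..r}. if k = i then if l = j then a else 0 else 0) = a"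
      using assms(1) by simp
  qed (use assms in \<open>auto intro!: subspace_0[OF subspace_A]\<close>)
  then show ?thesis by simp
qed

lemma cmp_star: "cmp (star a) i j = star (cmp a j i)"
proof -
  have "star a = star (\<Sum>i\<in>{1..r}. \<Sum>j\<in>{1..r}. cmp a i j)"
    by (simp only: sum_cmp)
  also have "\<dots> = (\<Sum>i\<in>{1..r}. \<Sum>j\<in>{1..r}. star (cmp a i j))"
    by (simp add: linear_sum[OF linear_star])
  also have "\<dots> = (\<Sum>j\<in>{1..r}. \<Sum>i\<in>{1..r}. star (cmp a i j))"
    by (rule sum.swap)
  finally have "cmp (star a) = (\<lambda>i j. star (cmp a j i))"
  proof (intro cmp_eqI)
    show "star (cmp a j i) \<in> A i j" if "i \<in> {1..r}" "j \<in> {1..r}" for i j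
      using star_A[OF that(2,1)] cmp_in[OF that(2,1)] by blast
  qed (use cmp_outside star_simps in auto)
  then show ?thesis by simp
qed

lemma cmp_mul: "cmp (mul a b) i k = (\<Sum>j\<in>{1..r}. mul (cmp a i j) (cmp b j k))"
proof -
  let ?I = "{1..r}"
  have l: "linear (\<lambda>x. mul x y)" and r: "linear (mul x)" for x y
    using bilinear_mul by (auto simp: bilinear_def)
  have "mul a b = mul (\<Sum>i\<in>?I. \<Sum>j\<in>?I. cmp a i j) (\<Sum>l\<in>?I. \<Sum>k\<in>?I. cmp b l k)"
    by (simp only: sum_cmp)
  also have "\<dots> = (\<Sum>i\<in>?I. \<Sum>j\<in>?I. \<Sum>l\<in>?I. \<Sum>k\<in>?I. mul (cmp a i j) (cmp b l k))"
    by (subst linear_sum[OF l], intro sum.cong refl, subst linear_sum[OF l], intro sum.cong refl)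
      (simp only: linear_sum[OF r])
  also have "\<dots> = (\<Sum>i\<in>?I. \<Sum>j\<in>?I. \<Sum>k\<in>?I. mul (cmp a i j) (cmp b j k))"
  proof (rule sum.cong[OF refl], rule sum.cong[OF refl])
    fix i j assume ij: "i \<in> ?I" "j \<in> ?I"
    have "mul (cmp a i j) (cmp b l k) = 0" if "l \<in> ?I" "k \<in> ?I" "l \<noteq> j" for l k
      by (rule mul_zero[OF ij that(1,2) _ cmp_in[OF ij] cmp_in[OF that(1,2)]]) (use that in simp)
    then have "(\<Sum>l\<in>?I. \<Sum>k\<in>?I. mul (cmp a i j) (cmp b l k))
        = (\<Sum>l\<in>?I. if l = j then \<Sum>k\<in>?I. mul (cmp a i j) (cmp b j k) else 0)"
      by (intro sum.cong refl) (simp add: sum.neutral)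
    then show "(\<Sum>l\<in>?I. \<Sum>k\<in>?I. mul (cmp a i j) (cmp b l k)) = (\<Sum>k\<in>?I. mul (cmp a i j) (cmp b j k))"
      using ij by simp
  qed
  also have "\<dots> = (\<Sum>i\<in>?I. \<Sum>k\<in>?I. \<Sum>j\<in>?I. mul (cmp a i j) (cmp b j k))"
    by (intro sum.cong refl sum.swap)
  finally have "cmp (mul a b) = (\<lambda>i k. \<Sum>j\<in>?I. mul (cmp a i j) (cmp b j k))"
  proof (intro cmp_eqI)
    show "(\<Sum>j\<in>?I. mul (cmp a i j) (cmp b j k)) \<in> A i k" if "i \<in> ?I" "k \<in> ?I" for i k
    proof (rule subspace_sum[OF subspace_A[OF that]])
      fix j assume j: "j \<in> ?I"
      show "mul (cmp a i j) (cmp b j k) \<in> A i k"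
        by (rule mul_in[OF that(1) j that(2) cmp_in[OF that(1) j] cmp_in[OF j that(2)]])
    qed
  qed (auto simp: cmp_outside mul_simps intro!: sum.neutral)
  then show ?thesis by simp
qed

text \<open>
  Index sets are relations so that supports multiply like relations: the support of a product is
  contained in the relational composition of the supports, that of \<open>star a\<close> in the converse.
\<close>

definition supp :: "(nat \<times> nat) set \<Rightarrow> 'a set" where
  "supp S = {a. \<forall>i j. (i, j) \<notin> S \<longrightarrow> cmp a i j = 0}"

lemma suppD: "a \<in> supp S \<Longrightarrow> (i, j) \<notin> S \<Longrightarrow> cmp a i j = 0"
  by (simp add: supp_def)

lemma subspace_supp: "subspace (supp S)"
  by (auto simp: subspace_def supp_def cmp_simps)

lemmas supp_closed = subspace_add[OF subspace_supp] subspace_diff[OF subspace_supp]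
  subspace_scale[OF subspace_supp] subspace_0[OF subspace_supp]

lemma supp_mono: "a \<in> supp S \<Longrightarrow> S \<subseteq> T \<Longrightarrow> a \<in> supp T"
  by (auto simp: supp_def)

lemma supp_eq_0:
  assumes "a \<in> supp S" "\<And>i j. (i, j) \<in> S \<Longrightarrow> i \<notin> {1..r} \<or> j \<notin> {1..r}"
  shows "a = 0"
proof (rule cmp_inject)
  fix i j
  show "cmp a i j = cmp 0 i j"
    using assms(2)[of i j] suppD[OF assms(1), of i j] cmp_outside[of i j a]
    by (cases "(i, j) \<in> S") (auto simp: cmp_simps)
qed

lemma homogeneous_in_supp: "i \<in> {1..r} \<Longrightarrow> j \<in> {1..r} \<Longrightarrow> a \<in> A i j \<Longrightarrow> a \<in> supp {(i, j)}"
  by (auto simp: supp_def cmp_homogeneous)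

lemma supp_singleton_cmp: "a \<in> supp {(i, j)} \<Longrightarrow> cmp a i j = a"
proof (rule cmp_inject)
  fix k l assume a: "a \<in> supp {(i, j)}"
  show "cmp (cmp a i j) k l = cmp a k l"
  proof (cases "i \<in> {1..r} \<and> j \<in> {1..r}")
    case True
    then show ?thesis using suppD[OF a, of k l] by (auto simp: cmp_homogeneous[OF _ _ cmp_in])
  next
    case False
    then show ?thesis
      using suppD[OF a, of k l] cmp_outside[of i j a] by (auto simp: cmp_simps)
  qed
qed

lemma cmp_in_supp: "cmp a i j \<in> supp {(i, j)}"
proof (cases "i \<in> {1..r} \<and> j \<in> {1..r}")
  case True
  then show ?thesis by (intro homogeneous_in_supp cmp_in) auto
next
  case False
  then have "cmp a i j = 0" by (intro cmp_outside) auto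
  then show ?thesis by (simp add: supp_closed)
qed

lemma star_in_supp:
  assumes "a \<in> supp S" "S\<inverse> \<subseteq> T"
  shows "star a \<in> supp T"
proof -
  have "star (cmp a j i) = 0" if "(i, j) \<notin> T" for i j
    using that assms by (subst suppD[OF assms(1)]) (auto simp: star_simps)
  then show ?thesis by (simp add: supp_def cmp_star)
qed

lemma mul_in_supp:
  assumes "a \<in> supp S" "b \<in> supp T" "S O T \<subseteq> X"
  shows "mul a b \<in> supp X"
proof -
  have "cmp (mul a b) i k = 0" if "(i, k) \<notin> X" for i k
  proof -
    have "mul (cmp a i j) (cmp b j k) = 0" for j
    proof (cases "(i, j) \<in> S")
      case True
      then have "(j, k) \<notin> T" using that assms(3) by auto
      then show ?thesis using assms(2) by (simp add: suppD mul_simps)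
    next
      case False
      then show ?thesis using assms(1) by (simp add: suppD mul_simps)
    qed
    then show ?thesis by (simp add: cmp_mul)
  qed
  then show ?thesis by (simp add: supp_def)
qed

lemma mul_eq_0:
  assumes "a \<in> supp S" "b \<in> supp T" "S O T = {}"
  shows "mul a b = 0"
  using mul_in_supp[OF assms(1,2), of "{}"] assms(3) supp_eq_0[of _ "{}"] by simp

lemma supp_Un_split:
  assumes "a \<in> supp (S \<union> T)"
  obtains p q where "a = p + q" "p \<in> supp S" "q \<in> supp T"
proof -
  let ?f = "\<lambda>i j. if (i, j) \<in> S then cmp a i j else 0"
  define p where "p = (\<Sum>i\<in>{1..r}. \<Sum>j\<in>{1..r}. ?f i j)"
  have "cmp p = ?f"
  proof (rule cmp_eqI)
    show "?f i j \<in> A i j" if "i \<in> {1..r}" "j \<in> {1..r}" for i j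
      using cmp_in[OF that] subspace_0[OF subspace_A[OF that]] by simp
  qed (use cmp_outside p_def in auto)
  then have "p \<in> supp S" "a - p \<in> supp T"
    using assms by (auto simp: supp_def cmp_simps)
  then show ?thesis using that[of p "a - p"] by simp
qed

lemma cmp_mul_column:
  assumes "a \<in> supp (S \<times> {k})"
  shows "cmp (mul a b) i l = mul (cmp a i k) (cmp b k l)"
proof (cases "k \<in> {1..r}")
  case True
  have "cmp (mul a b) i l = (\<Sum>j\<in>{1..r}. if j = k then mul (cmp a i k) (cmp b k l) else 0)"
    unfolding cmp_mul by (intro sum.cong refl) (use assms in \<open>auto simp: suppD mul_simps\<close>)
  then show ?thesis using True by simp
next
  case False
  then have "a = 0" using supp_eq_0[OF assms] by auto
  then show ?thesis by (simp add: mul_simps cmp_simps)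
qed

end

section \<open>Units and column vectors of a T-algebra\<close>

context T_algebra
begin

abbreviation e :: "nat \<Rightarrow> 'a" where
  "e \<equiv> diag_unit A \<rho>"

lemma rho_linear:
  assumes "i \<in> {1..r}" "x \<in> A i i"
  shows "\<rho> i (c *\<^sub>R x) = c * \<rho> i x" "\<rho> i 0 = 0"
proof -
  show *: "\<rho> i (c *\<^sub>R x) = c * \<rho> i x" for c
    using a1[OF assms(1)] assms(2) by (auto simp: algebra_iso_real_def)
  show "\<rho> i 0 = 0" using *[of 0] by simp
qed

lemma unit_in_A: "i \<in> {1..r} \<Longrightarrow> e i \<in> A i i"
  and rho_unit: "i \<in> {1..r} \<Longrightarrow> \<rho> i (e i) = 1"
proof -
  assume i: "i \<in> {1..r}"
  have surj: "\<rho> i ` A i i = UNIV" and inj: "inj_on (\<rho> i) (A i i)"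
    using a1[OF i] by (simp_all add: algebra_iso_real_def bij_betw_def)
  have "1 \<in> \<rho> i ` A i i" by (simp add: surj)
  then obtain x where "x \<in> A i i" "\<rho> i x = 1" by auto
  then have "\<exists>!x. x \<in> A i i \<and> \<rho> i x = 1"
    using inj_onD[OF inj] by (intro ex1I[of _ x]) auto
  from theI'[OF this] show "e i \<in> A i i" "\<rho> i (e i) = 1"
    by (auto simp: diag_unit_def)
qed

lemma unit_in_supp: "i \<in> {1..r} \<Longrightarrow> e i \<in> supp {(i, i)}"
  by (intro homogeneous_in_supp unit_in_A)

lemma diagonal_eq_unit:
  assumes "x \<in> supp {(i, i)}" "i \<in> {1..r}"
  shows "x = \<rho> i x *\<^sub>R e i"
proof -
  have x: "x \<in> A i i" using cmp_in[OF assms(2,2), of x] supp_singleton_cmp[OF assms(1)] by simp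
  show ?thesis
  proof (rule inj_onD[OF _ _ x])
    show "inj_on (\<rho> i) (A i i)"
      using a1[OF assms(2)] by (simp add: algebra_iso_real_def bij_betw_def)
    show "\<rho> i x = \<rho> i (\<rho> i x *\<^sub>R e i)"
      by (simp only: rho_linear(1)[OF assms(2) unit_in_A[OF assms(2)]] rho_unit[OF assms(2)] mult_1_right)
    show "\<rho> i x *\<^sub>R e i \<in> A i i"
      using assms(2) by (intro subspace_scale[OF subspace_A] unit_in_A)
  qed
qed

lemma mul_unit_right:
  assumes "u \<in> supp (S \<times> {k})" "k \<in> {1..r}"
  shows "mul u (e k) = u"
proof (rule cmp_inject)
  fix i l
  have "cmp (mul u (e k)) i l = mul (cmp u i k) (cmp (e k) k l)"
    by (rule cmp_mul_column[OF assms(1)])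
  also have "cmp (e k) k l = (if l = k then e k else 0)"
    using assms(2) unit_in_A by (simp add: cmp_homogeneous)
  finally have "cmp (mul u (e k)) i l = (if l = k then mul (cmp u i k) (e k) else 0)"
    by (simp add: mul_simps)
  moreover have "mul (cmp u i k) (e k) = cmp u i k"
    using a2[OF assms(2), of i u] assms(2) cmp_outside[of i k u] by (cases "i \<in> {1..r}") (auto simp: mul_simps)
  ultimately show "cmp (mul u (e k)) i l = cmp u i l"
    using suppD[OF assms(1), of i l] by simp
qed

lemma star_unit: "k \<in> {1..r} \<Longrightarrow> star (e k) = e k"
proof -
  assume k: "k \<in> {1..r}"
  have "star (e k) \<in> supp ({k} \<times> {k})"
    by (rule star_in_supp[OF unit_in_supp[OF k]]) auto
  then have *: "mul (star (e k)) (e k) = star (e k)" using k by (rule mul_unit_right)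
  have "mul (star (e k)) (e k) = star (mul (star (e k)) (e k))"
    by (simp add: star_mul star_star)
  then show ?thesis unfolding * by (simp add: star_star)
qed

lemma mul_unit_left:
  assumes "u \<in> supp (S \<times> {k})" "k \<in> {1..r}"
  shows "mul (e k) (star u) = star u"
  using arg_cong[OF mul_unit_right[OF assms], of star] assms(2) by (simp add: star_simps star_unit)

lemma square_eq_0: "mul a (star a) = 0 \<Longrightarrow> a = 0"
  using a5[of a] a5[of 0] by (simp add: mul_simps star_simps)

text \<open>
  The square of a homogeneous element has a single component, on the diagonal, and its coefficient
  there is the trace, to which \<open>a5\<close> applies.
\<close>

lemma homogeneous_square:
  assumes v: "v \<in> supp {(m, k)}" and m: "m \<in> {1..r}"
  obtains c where "c \<ge> 0" "mul v (star v) = c *\<^sub>R e m" "c = 0 \<longrightarrow> v = 0"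
proof -
  define c where "c = \<rho> m (mul v (star v))"
  have diag: "mul v (star v) \<in> supp {(m, m)}"
    by (rule mul_in_supp[OF v star_in_supp[OF v order_refl]]) auto
  then have eq: "mul v (star v) = c *\<^sub>R e m" using m unfolding c_def by (rule diagonal_eq_unit)
  have "\<rho> i (cmp (mul v (star v)) i i) = (if i = m then c else 0)" if "i \<in> {1..r}" for i
    using that suppD[OF diag, of i i] supp_singleton_cmp[OF diag] rho_linear(2)[OF that unit_in_A[OF that]]
    by (auto simp: c_def)
  then have "alg_trace r A \<rho> (mul v (star v)) = c"
    using m by (simp add: alg_trace_def)
  then have "c \<ge> 0" using a5[of v] by simp
  moreover have "c = 0 \<longrightarrow> v = 0" using eq square_eq_0[of v] by simp
  ultimately show ?thesis using that eq by blast
qed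

text \<open>
  The axiom \<open>a7\<close> summed over all rows of \<open>p\<close> and \<open>b\<close>. It can be checked componentwise because a
  product with a column vector on the left has single products as components.
\<close>

lemma column_assoc:
  assumes p: "p \<in> supp ({..m} \<times> {m})" and b: "b \<in> supp ({..k} \<times> {k})"
    and m: "1 \<le> m" "m \<le> k" "k \<le> r"
  shows "mul p (mul (cmp b m k) (star b)) = mul (mul p (cmp b m k)) (star b)"
proof (rule cmp_inject)
  fix i l
  let ?v = "cmp b m k"
  have v: "?v \<in> supp ({m} \<times> {k})" using cmp_in_supp[of b m k] by (rule supp_mono) auto
  have pv: "mul p ?v \<in> supp ({..m} \<times> {k})" by (rule mul_in_supp[OF p v]) auto
  have vv: "cmp ?v m k = ?v" using v by (intro supp_singleton_cmp) (rule supp_mono, auto)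
  have "cmp (mul p (mul ?v (star b))) i l = mul (cmp p i m) (mul ?v (star (cmp b l k)))"
    by (simp add: cmp_mul_column[OF p] cmp_mul_column[OF v] vv cmp_star)
  moreover have "cmp (mul (mul p ?v) (star b)) i l = mul (mul (cmp p i m) ?v) (star (cmp b l k))"
    by (simp add: cmp_mul_column[OF pv] cmp_mul_column[OF p] vv cmp_star)
  moreover have "mul (cmp p i m) (mul ?v (star (cmp b l k))) = mul (mul (cmp p i m) ?v) (star (cmp b l k))"
  proof (cases "1 \<le> i \<and> i \<le> m \<and> 1 \<le> l \<and> l \<le> k")
    case True
    then show ?thesis using a7 m by blast
  next
    case False
    then have "cmp p i m = 0 \<or> cmp b l k = 0"
      using suppD[OF p, of i m] suppD[OF b, of l k] cmp_outside[of i m p] cmp_outside[of l k b] m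
      by auto
    then show ?thesis by (auto simp: mul_simps star_simps)
  qed
  ultimately show "cmp (mul p (mul ?v (star b))) i l = cmp (mul (mul p ?v) (star b)) i l"
    by simp
qed

lemma column_assoc_same:
  assumes "p \<in> supp ({..m} \<times> {m})" "v \<in> supp {(m, k)}" "1 \<le> m" "m \<le> k" "k \<le> r"
  shows "mul (mul p v) (star v) = mul p (mul v (star v))"
proof -
  have "v \<in> supp ({..k} \<times> {k})" using assms(2,4) by (auto intro: supp_mono)
  from column_assoc[OF assms(1) this assms(3-5)] show ?thesis
    by (simp add: supp_singleton_cmp[OF assms(2)])
qed

text \<open>
  The axiom \<open>a7\<close> speaks of two components of one element. As \<open>v\<close> and \<open>w\<close> live in different rows, both occur
  in \<open>v + w\<close>; the contribution of \<open>v\<close> with itself is removed by \<open>column_assoc_same\<close>.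
\<close>

lemma column_assoc_distinct:
  assumes p: "p \<in> supp ({..m} \<times> {m})" and v: "v \<in> supp {(m, k)}" and w: "w \<in> supp ({..<m} \<times> {k})"
    and m: "1 \<le> m" "m \<le> k" "k \<le> r"
  shows "mul (mul p v) (star w) = mul p (mul v (star w))"
proof -
  have "v \<in> supp ({..k} \<times> {k})" "w \<in> supp ({..k} \<times> {k})"
    using v w m by (auto intro: supp_mono)
  then have "v + w \<in> supp ({..k} \<times> {k})" by (rule supp_closed)
  moreover have "cmp (v + w) m k = v"
    using suppD[OF w, of m k] supp_singleton_cmp[OF v] by (simp add: cmp_simps)
  ultimately have "mul p (mul v (star (v + w))) = mul (mul p v) (star (v + w))"
    using column_assoc[OF p _ m, of "v + w"] by simp
  then show ?thesis
    using column_assoc_same[OF p v m] by (simp add: mul_simps star_simps)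
qed

end

section \<open>Corner cones\<close>


text \<open>
  With a linear left inverse \<open>g\<close> of \<open>f\<close> on \<open>V\<close>, the image is described by the closed conditions
  \<open>g y \<in> S\<close> and \<open>f (g y) = y\<close>.
\<close>

lemma closed_linear_image_inj_on_subspace:
  fixes f :: "'a::euclidean_space \<Rightarrow> 'b::euclidean_space"
  assumes "linear f" "subspace V" "inj_on f V" "closed S" "S \<subseteq> V"
  shows "closed (f ` S)"
proof -
  obtain g where g: "linear g" "\<forall>v\<in>V. g (f v) = v"
    using linear_exists_left_inverse_on[OF assms(1-3)] by blast
  have "f ` S = g -` S \<inter> {y. f (g y) = y}"
  proof
    show "f ` S \<subseteq> g -` S \<inter> {y. f (g y) = y}" using g(2) assms(5) by auto
    show "g -` S \<inter> {y. f (g y) = y} \<subseteq> f ` S" by (auto intro: rev_image_eqI)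
  qed
  moreover have "continuous_on UNIV g" "continuous_on UNIV (\<lambda>y. f (g y))"
    using linear_continuous_on linear_conv_bounded_linear assms(1) g(1) linear_compose[OF g(1) assms(1)]
    by (auto simp: o_def)
  then have "closed (g -` S \<inter> {y. f (g y) = y})"
    by (intro closed_Int closed_vimage assms(4) closed_Collect_eq continuous_on_id)
  ultimately show ?thesis by simp
qed

context T_algebra
begin

text \<open>
  The vectors that border the upper left corner with indices \<open>1, \<dots>, k\<close>. The row index 0 is
  harmless, since components outside \<open>1, \<dots>, r\<close> are 0.
\<close>

definition column :: "nat \<Rightarrow> 'a set" where
  "column k = supp ({..k} \<times> {Suc k})"

definition hermitian_form :: "'a \<Rightarrow> 'a \<Rightarrow> 'a" where
  "hermitian_form u v = (1/2) *\<^sub>R (mul u (star v) + mul v (star u))"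

text \<open>
  The Hermitian block matrix with corner \<open>x\<close>, last column \<open>u\<close>, last row \<open>star u\<close> and last
  diagonal entry \<open>s\<close>.
\<close>

definition bordered :: "nat \<Rightarrow> 'a \<times> 'a \<times> real \<Rightarrow> 'a" where
  "bordered k = (\<lambda>(x, u, s). x + u + star u + s *\<^sub>R e (Suc k))"

primrec corner_cone :: "nat \<Rightarrow> 'a set" where
  "corner_cone 0 = {0}"
| "corner_cone (Suc k) = bordered k ` quadratic_extension (corner_cone k) (column k) hermitian_form"

lemma hermitian_form_self: "hermitian_form u u = mul u (star u)"
  by (simp add: hermitian_form_def flip: scaleR_2)

lemma bilinear_hermitian_form: "bilinear hermitian_form"
  by (auto simp: bilinear_def hermitian_form_def mul_simps star_simps algebra_simps intro!: linearI)

lemma linear_bordered: "linear (bordered k)"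
  by (auto simp: bordered_def star_simps algebra_simps intro!: linearI)

lemma subspace_column: "subspace (column k)"
  unfolding column_def by (rule subspace_supp)

lemma mul_star_add:
  assumes "v \<in> supp S" "w \<in> supp T" "S O T\<inverse> = {}"
  shows "mul (v + w) (star (v + w)) = mul v (star v) + mul w (star w)"
proof -
  have vw: "mul v (star w) = 0"
    by (rule mul_eq_0[OF assms(1) star_in_supp[OF assms(2) order_refl] assms(3)])
  have "mul w (star v) = star (mul v (star w))" by (simp add: star_simps)
  also have "\<dots> = 0" unfolding vw by (simp add: star_simps)
  finally show ?thesis using vw by (simp add: mul_simps star_simps)
qed

text \<open>
  One step of a Cholesky decomposition: for \<open>s \<noteq> 0\<close>, the Schur complement of the resulting block
  matrix is \<open>mul x (star x)\<close>.
\<close>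

lemma bordered_square:
  assumes x: "x \<in> supp ({..k} \<times> {..k})" and u: "u \<in> column k" and k: "Suc k \<le> r"
  shows "mul (x + u + s *\<^sub>R e (Suc k)) (star (x + u + s *\<^sub>R e (Suc k)))
    = bordered k (mul x (star x) + mul u (star u), s *\<^sub>R u, s * s)"
proof -
  have i: "Suc k \<in> {1..r}" using k by simp
  have u': "u \<in> supp ({..k} \<times> {Suc k})" using u by (simp add: column_def)
  have e: "e (Suc k) \<in> supp ({Suc k} \<times> {Suc k})" using unit_in_supp[OF i] by simp
  have "u + s *\<^sub>R e (Suc k) \<in> supp ({..Suc k} \<times> {Suc k})"
    by (intro supp_closed supp_mono[OF u'] supp_mono[OF e]) auto
  then have "mul (x + (u + s *\<^sub>R e (Suc k))) (star (x + (u + s *\<^sub>R e (Suc k))))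
      = mul x (star x) + mul (u + s *\<^sub>R e (Suc k)) (star (u + s *\<^sub>R e (Suc k)))"
    by (intro mul_star_add[OF x]) auto
  then show ?thesis
    by (simp add: bordered_def mul_simps star_simps star_unit[OF i] mul_unit_right[OF u' i]
        mul_unit_left[OF u' i] mul_unit_right[OF e i] algebra_simps)
qed

lemma bordered_eq_0:
  assumes x: "x \<in> supp ({..k} \<times> {..k})" and u: "u \<in> column k" and k: "Suc k \<le> r"
    and eq: "bordered k (x, u, s) = 0"
  shows "x = 0 \<and> u = 0 \<and> s = 0"
proof -
  let ?k = "Suc k"
  have i: "?k \<in> {1..r}" using k by simp
  have u': "u \<in> supp ({..k} \<times> {?k})" using u by (simp add: column_def)
  note zero = suppD[OF x] suppD[OF u'] suppD[OF unit_in_supp[OF i]]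
  have eq': "cmp x i j + cmp u i j + star (cmp u j i) + s *\<^sub>R cmp (e ?k) i j = 0" for i j
    using arg_cong[OF eq, of "\<lambda>a. cmp a i j"] by (simp add: bordered_def cmp_simps cmp_star)
  have "u = 0"
  proof (rule cmp_inject)
    fix i j
    show "cmp u i j = cmp 0 i j"
    proof (cases "i \<le> k \<and> j = ?k")
      case True
      then show ?thesis using eq'[of i j] by (simp add: zero star_simps cmp_simps)
    qed (auto simp: zero cmp_simps)
  qed
  moreover have "s *\<^sub>R e ?k = 0"
    using eq'[of ?k ?k] \<open>u = 0\<close> supp_singleton_cmp[OF unit_in_supp[OF i]]
    by (simp add: zero cmp_simps star_simps)
  then have "s = 0"
    using rho_linear[OF i unit_in_A[OF i]] rho_unit[OF i] by (metis mult_1_right)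
  ultimately show ?thesis using eq by (simp add: bordered_def star_simps)
qed

lemma corner_cone_supp: "k \<le> r \<Longrightarrow> corner_cone k \<subseteq> supp ({..k} \<times> {..k})"
proof (induction k)
  case 0
  then show ?case by (simp add: supp_closed)
next
  case (Suc k)
  have i: "Suc k \<in> {1..r}" using Suc.prems by simp
  have "bordered k (x, u, s) \<in> supp ({..Suc k} \<times> {..Suc k})"
    if "x \<in> corner_cone k" "u \<in> column k" for x u s
  proof -
    have "x \<in> supp ({..k} \<times> {..k})" "u \<in> supp ({..k} \<times> {Suc k})"
      using that Suc by (auto simp: column_def)
    then show ?thesis
      unfolding bordered_def prod.case using unit_in_supp[OF i]
      by (intro supp_closed star_in_supp[where S = "{..k} \<times> {Suc k}"])
        (auto intro: supp_mono)
  qed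
  then show ?case by (auto simp: quadratic_extension_def)
qed

lemma inj_on_bordered:
  assumes "Suc k \<le> r"
  shows "inj_on (bordered k) (supp ({..k} \<times> {..k}) \<times> column k \<times> UNIV)"
proof (rule inj_onI)
  fix y z assume yz: "y \<in> supp ({..k} \<times> {..k}) \<times> column k \<times> UNIV"
    "z \<in> supp ({..k} \<times> {..k}) \<times> column k \<times> UNIV" "bordered k y = bordered k z"
  then have "bordered k (y - z) = 0" by (simp add: linear_diff[OF linear_bordered])
  moreover have "y - z \<in> supp ({..k} \<times> {..k}) \<times> column k \<times> UNIV"
    using yz by (auto intro: supp_closed subspace_diff[OF subspace_column])
  ultimately have "y - z = 0"
    using bordered_eq_0[OF _ _ assms] by (cases "y - z") (auto simp: zero_prod_def)
  then show "y = z" by simp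
qed

lemma extension_corner_cone_subset:
  assumes "k \<le> r"
  shows "quadratic_extension (corner_cone k) (column k) hermitian_form
    \<subseteq> supp ({..k} \<times> {..k}) \<times> column k \<times> UNIV"
  using corner_cone_supp[OF assms] by (auto simp: quadratic_extension_def)

text \<open>
  Induction on the number of rows of the column. Split off the last entry, \<open>u = w + v\<close>, and put
  \<open>p = w v\<^sup>*\<close> and \<open>v v\<^sup>* = c e\<close>. Then \<open>u u\<^sup>*\<close> is the block matrix with corner \<open>w w\<^sup>*\<close>, last column \<open>p\<close> and
  last entry \<open>c\<close>, so that \<open>c w w\<^sup>* - p p\<^sup>*\<close> has to be in the smaller cone. If \<open>c = 0\<close>, then \<open>v\<close> and \<open>p\<close> vanish. Otherwise, with \<open>d = w - p v / c\<close>, the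
  part of \<open>w\<close> that is orthogonal to \<open>v\<close> in the sense that \<open>d v\<^sup>* = 0\<close>, this element is \<open>c d d\<^sup>*\<close>, again
  the square of a column, of the same column index but with one row less. Keeping the column index
  arbitrary, rather than the one next to the corner, is what makes the induction work.
\<close>

lemma column_square_in_corner_cone:
  assumes "m < k" "k \<le> r" "u \<in> supp ({..m} \<times> {k})"
  shows "mul u (star u) \<in> corner_cone m"
  using assms
proof (induction m arbitrary: u)
  case 0
  then have "u = 0" by (intro supp_eq_0[OF 0(3)]) auto
  then show ?case by (simp add: mul_simps)
next
  case (Suc m)
  let ?m = "Suc m"
  have i: "?m \<in> {1..r}" using Suc.prems by simp
  have "{..?m} \<times> {k} = {..m} \<times> {k} \<union> {(?m, k)}" by auto
  with Suc.prems(3) have "u \<in> supp ({..m} \<times> {k} \<union> {(?m, k)})" by simp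
  then obtain w v where u: "u = w + v"
    and w: "w \<in> supp ({..m} \<times> {k})" and v: "v \<in> supp {(?m, k)}"
    by (rule supp_Un_split)
  define p where "p = mul w (star v)"
  obtain c where c: "c \<ge> 0" "mul v (star v) = c *\<^sub>R e ?m" "c = 0 \<longrightarrow> v = 0"
    using homogeneous_square[OF v i] .
  have IH: "mul y (star y) \<in> corner_cone m" if "y \<in> supp ({..m} \<times> {k})" for y
    using Suc.IH[OF _ _ that] Suc.prems by simp
  have pm: "p \<in> supp ({..m} \<times> {?m})"
    unfolding p_def by (rule mul_in_supp[OF w star_in_supp[OF v order_refl]]) auto
  then have pm': "p \<in> supp ({..?m} \<times> {?m})" by (rule supp_mono) auto
  have star_p: "star p = mul v (star w)" by (simp add: p_def star_simps)
  have "c *\<^sub>R mul w (star w) - mul p (star p) \<in> corner_cone m"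
  proof (cases "c = 0")
    case True
    then have "p = 0" using c(3) by (simp add: p_def star_simps mul_simps)
    then show ?thesis using True IH[of 0] by (simp add: supp_closed mul_simps)
  next
    case False
    then have "c > 0" using c(1) by simp
    note assoc = column_assoc_distinct[OF pm' v _ _ _ Suc.prems(2)] column_assoc_same[OF pm' v _ _ Suc.prems(2)]
    have pv: "mul p v \<in> supp ({..m} \<times> {k})" by (rule mul_in_supp[OF pm v]) auto
    have lt: "{..m} = {..<?m}" by auto
    have pvw: "mul (mul p v) (star w) = mul p (star p)"
      using assoc(1)[of w] w Suc.prems(1) by (simp add: lt star_p)
    have pvv: "mul (mul p v) (star v) = c *\<^sub>R p"
      using assoc(2) Suc.prems(1) mul_unit_right[OF pm i] by (simp add: c(2) mul_simps)
    have "mul (mul p v) (star (mul p v)) = mul p (star (mul (mul p v) (star v)))"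
      using assoc(1)[of "mul p v"] pv Suc.prems(1) by (simp add: lt star_mul star_star)
    then have pvpv: "mul (mul p v) (star (mul p v)) = c *\<^sub>R mul p (star p)"
      by (simp only: pvv star_simps mul_simps)
    have wpv: "mul w (star (mul p v)) = mul p (star p)"
      using arg_cong[OF pvw, of star] by (simp add: star_simps)
    let ?d = "w - (1 / c) *\<^sub>R mul p v"
    let ?y = "sqrt c *\<^sub>R ?d"
    have "mul ?y (star ?y) = (sqrt c * sqrt c) *\<^sub>R mul ?d (star ?d)"
      by (simp only: linear_scale[OF linear_star] bilinear_lmul[OF bilinear_mul]
          bilinear_rmul[OF bilinear_mul] scaleR_scaleR)
    also have "mul ?d (star ?d) = mul w (star w) - (1 / c) *\<^sub>R mul w (star (mul p v))
        - (1 / c) *\<^sub>R (mul (mul p v) (star w) - (1 / c) *\<^sub>R mul (mul p v) (star (mul p v)))"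
      by (simp only: linear_scale[OF linear_star] linear_diff[OF linear_star] mul_simps)
         (simp add: algebra_simps)
    also have "sqrt c * sqrt c = c" using c(1) by simp
    also have "c *\<^sub>R (mul w (star w) - (1 / c) *\<^sub>R mul w (star (mul p v))
        - (1 / c) *\<^sub>R (mul (mul p v) (star w) - (1 / c) *\<^sub>R mul (mul p v) (star (mul p v))))
        = c *\<^sub>R mul w (star w) - mul p (star p)"
      using \<open>c > 0\<close> by (simp add: pvw wpv pvpv algebra_simps)
    finally have "c *\<^sub>R mul w (star w) - mul p (star p) = mul ?y (star ?y)" by simp
    also have "\<dots> \<in> corner_cone m"
      using w pv by (intro IH supp_closed)
    finally show ?thesis .
  qed
  then have "(mul w (star w), p, c) \<in> quadratic_extension (corner_cone m) (column m) hermitian_form"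
    using IH[OF w] pm c(1) by (simp add: quadratic_extension_def hermitian_form_self column_def)
  moreover have "mul u (star u) = bordered m (mul w (star w), p, c)"
    by (simp add: u bordered_def mul_simps star_simps star_p c(2) p_def algebra_simps)
  ultimately show ?case by auto
qed

lemma positive_quadratic_map_corner_cone:
  assumes "Suc k \<le> r" "convex_cone (corner_cone k)"
    and "\<And>x. x \<in> corner_cone k \<Longrightarrow> - x \<in> corner_cone k \<Longrightarrow> x = 0"
  shows "positive_quadratic_map (corner_cone k) (column k) hermitian_form"
proof
  show "hermitian_form u u \<in> corner_cone k" if "u \<in> column k" for u
    using that column_square_in_corner_cone[of k "Suc k" u] assms(1)
    by (simp add: hermitian_form_self column_def)
  show "u = 0" if "hermitian_form u u = 0" for u
    using square_eq_0[of u] that by (simp add: hermitian_form_self)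
  show "hermitian_form u v = hermitian_form v u" for u v
    by (simp add: hermitian_form_def add.commute)
qed (use assms subspace_column bilinear_hermitian_form in auto)

lemma corner_cone_pointed_convex:
  assumes "k \<le> r"
  shows "convex_cone (corner_cone k) \<and> (\<forall>x. x \<in> corner_cone k \<longrightarrow> - x \<in> corner_cone k \<longrightarrow> x = 0)"
  using assms
proof (induction k)
  case 0
  then show ?case by (simp add: convex_cone_iff)
next
  case (Suc k)
  then interpret positive_quadratic_map "corner_cone k" "column k" hermitian_form
    by (intro positive_quadratic_map_corner_cone) auto
  have "convex_cone (corner_cone (Suc k))"
    by (simp add: convex_cone_linear_image convex_cone_extension linear_bordered)
  moreover have "x = 0" if x: "x \<in> corner_cone (Suc k)" "- x \<in> corner_cone (Suc k)" for x
  proof -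
    obtain y z where y: "x = bordered k y" "y \<in> extension" and z: "- x = bordered k z" "z \<in> extension"
      using x by auto
    have "bordered k (y + z) = bordered k 0"
      unfolding linear_add[OF linear_bordered] linear_0[OF linear_bordered] by (simp flip: y(1) z(1))
    moreover have "y + z \<in> extension" "0 \<in> extension"
      using y z convex_cone_extension by (auto intro: convex_cone_add convex_cone_contains_0)
    moreover have "inj_on (bordered k) extension"
      using inj_on_subset[OF inj_on_bordered extension_corner_cone_subset] Suc.prems by simp
    ultimately have "y + z = 0" by (auto dest: inj_onD)
    then have "y = 0"
      using pointed_extension[OF y(2)] z(2) by (simp add: add_eq_0_iff)
    then show "x = 0" using y linear_0[OF linear_bordered] by simp
  qed
  ultimately show ?case by blast
qed

lemma positive_quadratic_map_step:
  "Suc k \<le> r \<Longrightarrow> positive_quadratic_map (corner_cone k) (column k) hermitian_form"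
  using corner_cone_pointed_convex[of k] by (intro positive_quadratic_map_corner_cone) auto

lemma longest_face_chain_corner_cone:
  "k \<le> r \<Longrightarrow> longest_face_chain_length (corner_cone k) (k + 1)"
proof (induction k)
  case 0
  then show ?case using longest_face_chain_length_zero by simp
next
  case (Suc k)
  interpret positive_quadratic_map "corner_cone k" "column k" hermitian_form
    using Suc.prems by (rule positive_quadratic_map_step)
  have "inj_on (bordered k) extension"
    using inj_on_subset[OF inj_on_bordered extension_corner_cone_subset] Suc.prems by simp
  with linear_bordered convex_cone_extension longest_face_chain_length_extension Suc
  have "longest_face_chain_length (bordered k ` extension) (k + 1 + 1)"
    by (intro longest_face_chain_length_linear_image) auto
  then show ?case by simp
qed

lemma closed_corner_cone: "k \<le> r \<Longrightarrow> closed (corner_cone k)"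
proof (induction k)
  case (Suc k)
  have "closed (quadratic_extension (corner_cone k) (column k) hermitian_form)"
    using Suc subspace_column bilinear_hermitian_form by (intro closed_quadratic_extension) auto
  moreover have "subspace (supp ({..k} \<times> {..k}) \<times> column k \<times> (UNIV :: real set))"
    by (intro subspace_Times subspace_supp subspace_column subspace_UNIV)
  ultimately show ?case
    using closed_linear_image_inj_on_subspace[OF linear_bordered _ inj_on_bordered _ extension_corner_cone_subset]
      Suc.prems by simp
qed simp

definition triangular :: "nat \<Rightarrow> 'a set" where
  "triangular k = supp {(i, j). i \<le> j \<and> j \<le> k}"

lemma triangular_Suc_split:
  assumes "t \<in> triangular (Suc k)" "Suc k \<le> r"
  obtains t' u s where "t = t' + u + s *\<^sub>R e (Suc k)" "t' \<in> triangular k" "u \<in> column k"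
proof -
  have i: "Suc k \<in> {1..r}" using assms by simp
  have "{(i, j). i \<le> j \<and> j \<le> Suc k} = {(i, j). i \<le> j \<and> j \<le> k} \<union> ({..k} \<times> {Suc k} \<union> {(Suc k, Suc k)})"
    by (auto simp: le_Suc_eq)
  then have "t \<in> supp ({(i, j). i \<le> j \<and> j \<le> k} \<union> ({..k} \<times> {Suc k} \<union> {(Suc k, Suc k)}))"
    using assms(1) by (simp add: triangular_def)
  then obtain t' w where t': "t = t' + w" "t' \<in> supp {(i, j). i \<le> j \<and> j \<le> k}"
    and w: "w \<in> supp ({..k} \<times> {Suc k} \<union> {(Suc k, Suc k)})"
    by (rule supp_Un_split)
  from w obtain u d where u: "w = u + d" "u \<in> supp ({..k} \<times> {Suc k})"
    and d: "d \<in> supp {(Suc k, Suc k)}"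
    by (rule supp_Un_split)
  have "t = t' + u + \<rho> (Suc k) d *\<^sub>R e (Suc k)"
    using t' u diagonal_eq_unit[OF d i] by (simp add: add.assoc)
  then show ?thesis
    by (rule that) (use t' u in \<open>simp_all add: triangular_def column_def\<close>)
qed

lemma triangular_subset_square: "triangular k \<subseteq> supp ({..k} \<times> {..k})"
  unfolding triangular_def by (auto intro: supp_mono)

text \<open>
  For a triangular \<open>t\<close> with corner \<open>t'\<close>, last column \<open>u\<close> and last entry \<open>s\<close>, the condition on the
  block matrix \<open>mul t (star t)\<close> is that \<open>s\<^sup>2 t' t'\<^sup>*\<close> lies in the smaller cone.
\<close>

lemma triangular_square_in_corner_cone:
  "k \<le> r \<Longrightarrow> t \<in> triangular k \<Longrightarrow> mul t (star t) \<in> corner_cone k"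
proof (induction k arbitrary: t)
  case 0
  have "t = 0" by (rule supp_eq_0[OF 0(2)[unfolded triangular_def]]) auto
  then show ?case by (simp add: mul_simps)
next
  case (Suc k)
  interpret positive_quadratic_map "corner_cone k" "column k" hermitian_form
    using Suc.prems(1) by (rule positive_quadratic_map_step)
  obtain t' u s where t: "t = t' + u + s *\<^sub>R e (Suc k)" "t' \<in> triangular k" "u \<in> column k"
    using triangular_Suc_split[OF Suc.prems(2,1)] .
  have t'_square: "mul t' (star t') \<in> corner_cone k" using Suc t by simp
  have "mul u (star u) \<in> corner_cone k" using Q_in[OF t(3)] by (simp add: hermitian_form_self)
  then have "(mul t' (star t') + mul u (star u), s *\<^sub>R u, s * s) \<in> extension"
    using t t'_square cone_K subspace_column
    by (simp add: quadratic_extension_def convex_cone_add subspace_scale hermitian_form_self mul_simps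
        linear_scale[OF linear_star] scaleR_add_right convex_cone_scaleR)
  moreover have "mul t (star t) = bordered k (mul t' (star t') + mul u (star u), s *\<^sub>R u, s * s)"
    using t triangular_subset_square Suc.prems by (simp add: bordered_square subset_iff)
  ultimately show ?case by auto
qed

definition triangular_pos :: "nat \<Rightarrow> 'a set" where
  "triangular_pos k = {t \<in> triangular k. \<forall>i\<in>{1..k}. \<rho> i (cmp t i i) > 0}"

lemma triangular_pos_Suc:
  assumes t: "t \<in> triangular_pos k" and u: "u \<in> column k" and s: "s > 0" and k: "Suc k \<le> r"
  shows "t + u + s *\<^sub>R e (Suc k) \<in> triangular_pos (Suc k)"
proof -
  have i: "Suc k \<in> {1..r}" using k by simp
  have t': "t \<in> supp {(i, j). i \<le> j \<and> j \<le> k}" using t by (simp add: triangular_pos_def triangular_def)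
  have u': "u \<in> supp ({..k} \<times> {Suc k})" using u by (simp add: column_def)
  have "t + u + s *\<^sub>R e (Suc k) \<in> triangular (Suc k)"
    unfolding triangular_def using t' u' unit_in_supp[OF i]
    by (intro supp_closed) (auto intro: supp_mono)
  moreover have "\<rho> j (cmp (t + u + s *\<^sub>R e (Suc k)) j j) > 0" if j: "j \<in> {1..Suc k}" for j
  proof (cases "j = Suc k")
    case True
    then have "cmp (t + u + s *\<^sub>R e (Suc k)) j j = s *\<^sub>R e (Suc k)"
      using suppD[OF t'] suppD[OF u'] supp_singleton_cmp[OF unit_in_supp[OF i]] by (simp add: cmp_simps)
    then show ?thesis using s True rho_linear[OF i unit_in_A[OF i]] rho_unit[OF i] by simp
  next
    case False
    then have "cmp (t + u + s *\<^sub>R e (Suc k)) j j = cmp t j j"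
      using suppD[OF u', of j j] suppD[OF unit_in_supp[OF i], of j j] by (simp add: cmp_simps)
    then show ?thesis using t j False by (simp add: triangular_pos_def)
  qed
  ultimately show ?thesis by (simp add: triangular_pos_def)
qed

text \<open>
  At positive height, the last column and the last entry of the triangular factor are determined
  by \<open>u\<close> and \<open>s\<close>, and the corner is obtained from an approximation of the Schur complement. Points of
  height 0 are limits of points of positive height.
\<close>

lemma corner_cone_subset_closure:
  "k \<le> r \<Longrightarrow> corner_cone k \<subseteq> closure ((\<lambda>t. mul t (star t)) ` triangular_pos k)"
proof (induction k)
  case 0
  have "0 \<in> (\<lambda>t. mul t (star t)) ` triangular_pos 0"
    by (rule image_eqI[of _ _ 0]) (simp_all add: triangular_pos_def triangular_def supp_closed mul_simps)
  then show ?case using subsetD[OF closure_subset] by simp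
next
  case (Suc k)
  interpret positive_quadratic_map "corner_cone k" "column k" hermitian_form
    using Suc.prems by (rule positive_quadratic_map_step)
  let ?P = "\<lambda>k. (\<lambda>t. mul t (star t)) ` triangular_pos k"
  have IH: "corner_cone k \<subseteq> closure (?P k)" using Suc by simp
  have interior: "bordered k (x, u, s) \<in> closure (?P (Suc k))" if "(x, u, s) \<in> extension" "s > 0" for x u s
  proof -
    define q where "q = sqrt s"
    define w where "w = (1 / q) *\<^sub>R u"
    have q: "q > 0" "q * q = s" "q *\<^sub>R w = u" using \<open>s > 0\<close> by (auto simp: q_def w_def)
    have w: "w \<in> column k"
      using that subspace_column by (auto simp: w_def quadratic_extension_def intro: subspace_scale)
    let ?f = "\<lambda>y. bordered k (y + mul w (star w), u, s)"
    have "continuous_on UNIV ?f"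
      unfolding bordered_def prod.case by (intro continuous_intros)
    then have "?f ` closure (?P k) \<subseteq> closure (?f ` ?P k)"
      by (intro image_closure_subset[OF _ closed_closure closure_subset])
        (auto intro: continuous_on_subset)
    also have "?f ` ?P k \<subseteq> ?P (Suc k)"
    proof clarify
      fix t assume t: "t \<in> triangular_pos k"
      then have "t \<in> supp ({..k} \<times> {..k})"
        using triangular_subset_square by (auto simp: triangular_pos_def)
      then have "?f (mul t (star t)) = mul (t + w + q *\<^sub>R e (Suc k)) (star (t + w + q *\<^sub>R e (Suc k)))"
        using Suc.prems w by (simp add: bordered_square q)
      then show "?f (mul t (star t)) \<in> ?P (Suc k)"
        using triangular_pos_Suc[OF t w q(1) Suc.prems] by blast
    qed
    finally have *: "?f ` closure (?P k) \<subseteq> closure (?P (Suc k))" by (simp add: closure_mono)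
    have "s *\<^sub>R x - mul u (star u) \<in> corner_cone k"
      using that by (simp add: quadratic_extension_def hermitian_form_self)
    moreover have "s *\<^sub>R (x - mul w (star w)) = s *\<^sub>R x - mul u (star u)"
      by (simp add: scaleR_diff_right mul_simps linear_scale[OF linear_star] flip: q(2,3))
    ultimately have "x - mul w (star w) \<in> corner_cone k"
      using scaleR_in_K_iff[OF \<open>s > 0\<close>] by metis
    then have "?f (x - mul w (star w)) \<in> closure (?P (Suc k))" using IH * by blast
    then show ?thesis by simp
  qed
  show ?case
  proof
    fix z assume "z \<in> corner_cone (Suc k)"
    then obtain x u s where z: "z = bordered k (x, u, s)" "(x, u, s) \<in> extension" by auto
    from z(2) show "z \<in> closure (?P (Suc k))"
    proof (cases rule: extension_height_cases)
      case 1
      have lim: "(\<lambda>n. bordered k (x, 0, inverse (real (Suc n)))) \<longlonglongrightarrow> bordered k (x, 0, 0)"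
        unfolding bordered_def prod.case by (intro tendsto_intros LIMSEQ_inverse_real_of_nat)
      have "bordered k (x, 0, inverse (real (Suc n))) \<in> closure (?P (Suc k))" for n
        using 1 subspace_0[OF subspace_column]
        by (intro interior) (auto simp: extension_pos_height_iff Q_simps intro: convex_cone_scaleR[OF cone_K])
      then have "bordered k (x, 0, 0) \<in> closure (?P (Suc k))"
        by (rule closed_sequentially[OF closed_closure _ lim])
      then show ?thesis using z 1 by simp
    next
      case 2
      then show ?thesis using interior z by simp
    qed
  qed
qed

lemma closure_T_cone: "closure (T_cone r A mul star \<rho>) = corner_cone r"
proof -
  have "upper_triangular r A = triangular r"
  proof (intro set_eqI iffI)
    fix t assume t: "t \<in> upper_triangular r A"
    have "cmp t i j = 0" if "\<not> (i \<le> j \<and> j \<le> r)" for i j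
      using t that cmp_outside[of i j t] by (cases "i \<in> {1..r} \<and> j \<in> {1..r}") (auto simp: upper_triangular_def)
    then show "t \<in> triangular r" by (auto simp: triangular_def supp_def)
  next
    fix t assume "t \<in> triangular r"
    then show "t \<in> upper_triangular r A" by (auto simp: upper_triangular_def triangular_def supp_def)
  qed
  then have T: "T_cone r A mul star \<rho> = (\<lambda>t. mul t (star t)) ` triangular_pos r"
    by (auto simp: T_cone_def upper_triangular_pos_def triangular_pos_def)
  have "T_cone r A mul star \<rho> \<subseteq> corner_cone r"
    using triangular_square_in_corner_cone by (auto simp: T triangular_pos_def)
  then have "closure (T_cone r A mul star \<rho>) \<subseteq> corner_cone r"
    using closed_corner_cone by (simp add: closure_minimal)
  then show ?thesis using corner_cone_subset_closure[of r] T by auto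
qed

end

theorem corollary3p9:
  fixes r :: nat
    and A :: "nat \<Rightarrow> nat \<Rightarrow> 'a::euclidean_space set"
    and mul :: "'a \<Rightarrow> 'a \<Rightarrow> 'a"
    and star :: "'a \<Rightarrow> 'a"
    and \<rho> :: "nat \<Rightarrow> 'a \<Rightarrow> real"
  assumes "T_algebra r A mul star \<rho>"
  shows "longest_face_chain_length (closure (T_cone r A mul star \<rho>)) (r + 1)"
proof -
  interpret T_algebra r A mul star \<rho> by fact
  show ?thesis using longest_face_chain_corner_cone[of r] by (simp add: closure_T_cone)
qed

end
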